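(* Let $m$ be a square-free positive integer, let $\vartheta=\sqrt[4]{m}$, and let $K=\mathbb{Q}(i,\vartheta)$. (1) If $m\equiv 2\pmod 4$, then an integral basis of $K$ is $$\left\{ 1,\ \vartheta,\ \vartheta^2,\ \vartheta^3,\ i,\ \frac{(1+i)\vartheta+\vartheta^3}{2},\ \frac{(1+i)\vartheta^2}{2},\ \frac{(1+i)\vartheta^3}{2}\right\}$$ and the discriminant of $K$ is $D_K=2^{18}\, m^6$. (2) If $m\equiv 3\pmod 4$, then an integral basis of $K$ is $$\left\{1,\ \vartheta,\ \vartheta^2,\ \vartheta^3,\ \frac{i+\vartheta^2}{2},\ \frac{i\vartheta+\vartheta^3}{2},\ \frac{1+i\vartheta^2}{2},\ \frac{\vartheta+i\vartheta^3}{2}\right\}$$ and the discriminant of $K$ is $D_K=2^{16}\, m^6$.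
   Context: Here $i$ is the imaginary unit ($i^2=-1$) and $\sqrt[4]{m}$ is the positive real fourth root of $m$. An integral basis of a number field $K$ is a $\mathbb{Z}$-basis of its ring of integers $\mathbb{Z}_K$, and $D_K$ denotes the (absolute) discriminant of $K$ over $\mathbb{Q}$. *)

theory Defs
  imports
    "HOL-Algebra.Generated_Fields"
    "HOL-Algebra.Algebraic_Closure_Type"
    "HOL-Computational_Algebra.Computational_Algebra"
    "HOL-Number_Theory.Cong"
    "HOL-Analysis.Analysis"
    "Jordan_Normal_Form.Determinant"
begin

text \<open>
  Number fields are represented as subfields \<open>K\<close> of the complex numbers, given by their carrier
  sets. The notions below have their usual meaning when \<open>K\<close> is a subfield of finite degree over
  the rationals.
\<close>

abbreviation complex_field :: "complex ring" where
  "complex_field \<equiv> ring_of_type_algebra"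

definition rat_adjoin :: "complex set \<Rightarrow> complex set" where
  "rat_adjoin S = generate_field complex_field S"

definition ring_of_integers :: "complex set \<Rightarrow> complex set" where
  "ring_of_integers K = {x \<in> K. algebraic_int x}"

global_interpretation int_module: Modules.module "\<lambda>(k::int) (x::complex). of_int k * x"
  by unfold_locales (simp_all add: algebra_simps)

definition integral_basis :: "complex set \<Rightarrow> complex list \<Rightarrow> bool" where
  "integral_basis K bs \<longleftrightarrow>
     distinct bs \<and> int_module.independent (set bs) \<and>
     int_module.span (set bs) = ring_of_integers K"

text \<open>
  Embeddings are made extensional (\<open>undefined\<close> outside \<open>K\<close>) so that each field homomorphism from
  \<open>K\<close> to the complex numbers is counted exactly once.
\<close>

definition embeddings :: "complex set \<Rightarrow> (complex \<Rightarrow> complex) set" where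
  "embeddings K = Ring.ring_hom (complex_field\<lparr>carrier := K\<rparr>) complex_field \<inter> extensional K"

definition field_trace :: "complex set \<Rightarrow> complex \<Rightarrow> complex" where
  "field_trace K x = (\<Sum>\<sigma>\<in>embeddings K. \<sigma> x)"

definition basis_discriminant :: "complex set \<Rightarrow> complex list \<Rightarrow> complex" where
  "basis_discriminant K bs =
     Determinant.det (Matrix.mat (length bs) (length bs) (\<lambda>(i, j). field_trace K (bs ! i * bs ! j)))"

text \<open>
  The discriminant is the common value of \<^const>\<open>basis_discriminant\<close> on all integral bases,
  which is a rational integer.
\<close>

definition field_discriminant :: "complex set \<Rightarrow> int" where
  "field_discriminant K =
     (THE d. \<exists>bs. integral_basis K bs \<and> of_int d = basis_discriminant K bs)"

end

theory Submission
  imports Defs "Jordan_Normal_Form.Char_Poly"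
begin

text \<open>
  Write \<open>x = a + b \<theta> + c \<theta>\<^sup>2 + d \<theta>\<^sup>3\<close> with coefficients in \<open>\<rat>(\<i>)\<close>. If \<open>x\<close> is integral, averaging over the
  eight conjugates shows that \<open>8 p \<theta>\<^sup>k\<close> is integral for the real and the imaginary part \<open>p\<close> of every coefficient;
  since \<open>m\<close> is square-free and \<open>k < 4\<close>, this forces \<open>8 p \<in> \<int>\<close>. Hence every denominator is a power of the
  prime \<open>1 + \<i>\<close> of \<open>\<int>[\<i>]\<close>, and it remains to see that no element of the claimed lattice \<open>L\<close>
  outside \<open>(1 + \<i>) L\<close> stays integral after division by \<open>1 + \<i>\<close>. As squaring is additive modulo two,
  repeated squaring reduces this to divisibility by two in \<open>\<int>\<close>. The discriminant is obtained from
  the trace form on the monomials \<open>\<i>\<^sup>r \<theta>\<^sup>s\<close>, which is a monomial matrix, and a triangular change of basis.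
\<close>

section \<open>Integer spans and algebraic integers\<close>

text \<open>The basic integrality test is that \<open>Z[\<i>]\<close> is integrally closed in its
  fraction field, so every argument at the prime over 2 has to eliminate \<theta> while preserving
  integrality. Testing the 15 nonzero residue vectors one by one with polynomials of degree eight is
  avoided: a bit equals its own square, so one symbolic squaring treats all vectors together, and
  norms or traces under \<theta> -> \<open>\<i> * \<theta>\<close> finish. The bound 8 is 4, from
  summing over the four roots of \<open>X^4 = m\<close>, times 2, from separating real and imaginary
  parts. The lattice generators have simple origins. If \<open>m = 2 k\<close> with \<open>k\<close>
  odd, \<open>(1 + \<i>) * \<theta>^2 / 2\<close> has square \<open>\<i> * k\<close>, so it and its
  product with \<theta> are integral; the last generator is the one whose square falls back on
  these. If \<open>m = 4 k - 1\<close>, \<open>\<i> * \<theta>^2\<close> is a square root of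
  \<open>- m\<close>, which is 1 modulo 4, so \<open>(1 + \<i> * \<theta>^2) / 2\<close> generates
  the integers of a quadratic field; the lattice is spanned by 1, \<theta> and their multiples by
  it. That \<open>m\<close> is no square, automatic in both classes, gives unique coordinates and
  eight embeddings.\<close>

text \<open>As a simplification rule this loops against \<open>of_int_mult\<close> and \<open>mult.assoc\<close>.\<close>

declare int_module.scale_scale [simp del]

text \<open>Coefficients are indexed by list position rather than by element, the form in which they
  become rows of a matrix.\<close>

lemma span_set_list:
  "int_module.span (set bs) = range (\<lambda>n. \<Sum>j<length bs. of_int (n j) * bs ! j)"
  (is "_ = range ?f")
proof
  have "int_module.subspace (range ?f)"
    unfolding int_module.subspace_def
  proof (intro conjI ballI allI)
    show "0 \<in> range ?f"
      by (rule range_eqI[of _ _ "\<lambda>_. 0"]) simp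
  next
    fix x y assume "x \<in> range ?f" "y \<in> range ?f"
    then obtain a b where "x = ?f a" "y = ?f b" by blast
    then have "x + y = ?f (\<lambda>j. a j + b j)"
      by (simp add: sum.distrib algebra_simps)
    then show "x + y \<in> range ?f" using rangeI[of ?f "\<lambda>j. a j + b j"] by (simp only:)
  next
    fix c x assume "x \<in> range ?f"
    then obtain a where "x = ?f a" by blast
    then have "of_int c * x = ?f (\<lambda>j. c * a j)"
      by (simp add: sum_distrib_left mult.assoc)
    then show "of_int c * x \<in> range ?f" using rangeI[of ?f "\<lambda>j. c * a j"] by (simp only:)
  qed
  moreover have "set bs \<subseteq> range ?f"
  proof
    fix x assume "x \<in> set bs"
    then obtain k where k: "k < length bs" "x = bs ! k"
      by (auto simp: in_set_conv_nth)
    have "?f (\<lambda>j. if j = k then 1 else 0) = (\<Sum>j<length bs. if j = k then bs ! j else 0)"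
      by (intro sum.cong) auto
    also have "\<dots> = x" using k by simp
    finally show "x \<in> range ?f"
      using rangeI[of ?f "\<lambda>j. if j = k then 1 else 0"] by (simp only:)
  qed
  ultimately show "int_module.span (set bs) \<subseteq> range ?f"
    by (intro int_module.span_minimal)
  show "range ?f \<subseteq> int_module.span (set bs)"
    by (intro image_subsetI int_module.span_sum int_module.span_scale int_module.span_base) simp
qed

text \<open>A repeated entry is invisible to \<open>set bs\<close> but yields a nontrivial relation
  between positions, so independence by position captures \<open>distinct\<close> as well.\<close>

lemma distinct_independent_iff:
  "distinct bs \<and> int_module.independent (set bs) \<longleftrightarrow>
     (\<forall>n. (\<Sum>j<length bs. of_int (n j) * bs ! j) = 0 \<longrightarrow> (\<forall>j<length bs. n j = 0))"
  (is "?L \<longleftrightarrow> ?R")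
proof
  assume L: ?L
  then have bij: "bij_betw ((!) bs) {..<length bs} (set bs)"
    by (simp add: bij_betw_nth)
  show ?R
  proof (intro allI impI)
    fix n j assume n: "(\<Sum>j<length bs. of_int (n j) * bs ! j) = 0" and j: "j < length bs"
    define u where "u = n \<circ> the_inv_into {..<length bs} ((!) bs)"
    have u: "u (bs ! k) = n k" if "k < length bs" for k
      using that bij by (simp add: u_def the_inv_into_f_f bij_betw_def)
    have "(\<Sum>v\<in>set bs. of_int (u v) * v) = (\<Sum>k<length bs. of_int (u (bs ! k)) * bs ! k)"
      by (rule sum.reindex_bij_betw[OF bij, symmetric])
    also have "\<dots> = 0" using n u by simp
    finally have "u (bs ! j) = 0"
      using L j int_module.independentD[of "set bs" "set bs" u "bs ! j"] by simp
    then show "n j = 0" using u j by simp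
  qed
next
  assume R: ?R
  have d: "distinct bs"
  proof (rule ccontr)
    assume "\<not> distinct bs"
    then obtain i k where ik: "i < length bs" "k < length bs" "i \<noteq> k" "bs ! i = bs ! k"
      by (auto simp: distinct_conv_nth)
    define n :: "nat \<Rightarrow> int" where "n j = (if j = i then 1 else 0) - (if j = k then 1 else 0)" for j
    have "(\<Sum>j<length bs. of_int (n j) * bs ! j) =
        (\<Sum>j<length bs. if j = i then bs ! j else 0) - (\<Sum>j<length bs. if j = k then bs ! j else 0)"
      unfolding sum_subtractf[symmetric] by (intro sum.cong) (auto simp: n_def)
    also have "\<dots> = 0" using ik by simp
    finally have "n i = 0" using R ik by blast
    then show False using ik by (simp add: n_def)
  qed
  then have bij: "bij_betw ((!) bs) {..<length bs} (set bs)"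
    by (simp add: bij_betw_nth)
  have "u v = 0" if "(\<Sum>v\<in>set bs. of_int (u v) * v) = 0" "v \<in> set bs" for u v
  proof -
    have "(\<Sum>k<length bs. of_int (u (bs ! k)) * bs ! k) = 0"
      using that(1) sum.reindex_bij_betw[OF bij, of "\<lambda>v. of_int (u v) * v"] by simp
    then have "\<forall>k<length bs. u (bs ! k) = 0" using R[rule_format, of "\<lambda>k. u (bs ! k)"] by blast
    then show ?thesis using that(2) by (auto simp: in_set_conv_nth)
  qed
  then have "int_module.independent (set bs)"
    by (subst int_module.dependent_finite) auto
  with d show ?L by blast
qed

text \<open>Determinant trick: multiplication by \<open>x\<close> acts on \<open>S\<close> through
  an integer matrix, and the vector of elements of \<open>S\<close>, nonzero because it contains 1,
  is an eigenvector for \<open>x\<close>. So \<open>x\<close> is a root of a monic integral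
  characteristic polynomial.\<close>

lemma algebraic_int_if_span_stable:
  fixes S :: "complex set"
  assumes "finite S" "1 \<in> S" and stable: "\<And>s. s \<in> S \<Longrightarrow> x * s \<in> int_module.span S"
  shows "algebraic_int x"
proof -
  obtain vs where vs: "set vs = S" using finite_list[OF assms(1)] by blast
  define n where "n = length vs"
  have "\<exists>c. \<forall>i<n. x * vs ! i = (\<Sum>j<n. of_int (c i j :: int) * vs ! j)"
  proof -
    have "\<exists>c. x * vs ! i = (\<Sum>j<n. of_int (c j :: int) * vs ! j)" if "i < n" for i
      using stable[of "vs ! i"] that vs unfolding n_def vs[symmetric] span_set_list by force
    then show ?thesis by metis
  qed
  then obtain c where c: "\<And>i. i < n \<Longrightarrow> x * vs ! i = (\<Sum>j<n. of_int (c i j :: int) * vs ! j)"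
    by blast
  define A where "A = Matrix.mat n n (\<lambda>(i, j). c i j)"
  define A' where "A' = (of_int_hom.mat_hom A :: complex mat)"
  define v where "v = Matrix.vec n (\<lambda>i. vs ! i)"
  have A: "A \<in> carrier_mat n n" and A': "A' \<in> carrier_mat n n"
    by (auto simp: A_def A'_def)
  obtain k where k: "k < n" "vs ! k = 1"
    using assms(2) vs by (auto simp: in_set_conv_nth n_def)
  then have "v \<noteq> 0\<^sub>v n"
    by (metis index_vec index_zero_vec(1) v_def zero_neq_one)
  moreover have "A' *\<^sub>v v = x \<cdot>\<^sub>v v"
    by (rule eq_vecI)
       (auto simp: A'_def A_def v_def scalar_prod_def c atLeast0LessThan)
  ultimately have "eigenvalue A' x"
    using A' unfolding eigenvalue_def eigenvector_def by (auto intro!: exI[of _ v] simp: v_def)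
  then have "poly (char_poly A') x = 0"
    using eigenvalue_root_char_poly[OF A'] by simp
  moreover have "char_poly A' = map_poly of_int (char_poly A)"
    unfolding A'_def by (rule of_int_hom.char_poly_hom[OF A])
  moreover have "lead_coeff (char_poly A) = 1"
    using degree_monic_char_poly[OF A] by simp
  ultimately show ?thesis unfolding algebraic_int_altdef_ipoly by metis
qed

lemma algebraic_int_power_in_span:
  fixes x :: complex
  assumes "algebraic_int x"
  obtains n where "n > 0" "x ^ n \<in> int_module.span (power x ` {..<n})"
proof -
  obtain p where p: "poly (map_poly of_int p) x = 0" "lead_coeff p = 1"
    using assms by (auto simp: algebraic_int_altdef_ipoly)
  define n where "n = degree p"
  have "n > 0"
    using p by (intro Nat.gr0I) (auto simp: n_def elim!: degree_eq_zeroE)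
  have "0 = (\<Sum>i\<le>n. of_int (coeff p i) * x ^ i)"
    using p(1) by (simp add: poly_altdef coeff_map_poly degree_map_poly n_def)
  also have "{..n} = insert n {..<n}" by auto
  finally have "x ^ n = (\<Sum>i<n. of_int (- coeff p i) * x ^ i)"
    using p(2) by (simp add: n_def add_eq_0_iff2 sum_negf)
  also have "\<dots> \<in> int_module.span (power x ` {..<n})"
    by (intro int_module.span_sum int_module.span_scale int_module.span_base) auto
  finally show ?thesis using that \<open>n > 0\<close> by blast
qed

lemma int_span_mult_left:
  assumes "\<And>s. s \<in> S \<Longrightarrow> c * s \<in> int_module.span T" and "y \<in> int_module.span S"
  shows "c * y \<in> int_module.span T"
proof -
  have "int_module.subspace {y. c * y \<in> int_module.span T}"
    unfolding int_module.subspace_def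
    by (auto simp: distrib_left mult.left_commute[of c]
        intro: int_module.span_zero int_module.span_add int_module.span_scale)
  with assms show ?thesis
    using int_module.span_minimal[of S "{y. c * y \<in> int_module.span T}"] by blast
qed

text \<open>Products of powers of \<open>x\<close> and \<open>y\<close> below the degrees of their
  monic equations span a module stable under both, which serves sum and product alike.\<close>

lemma algebraic_int_common_span:
  fixes x y :: complex
  assumes "algebraic_int x" "algebraic_int y"
  obtains S where "finite S" "1 \<in> S" "\<And>s. s \<in> S \<Longrightarrow> x * s \<in> int_module.span S"
    "\<And>s. s \<in> S \<Longrightarrow> y * s \<in> int_module.span S"
proof -
  obtain n where n: "n > 0" "x ^ n \<in> int_module.span (power x ` {..<n})"
    using algebraic_int_power_in_span[OF assms(1)] by blast
  obtain k where k: "k > 0" "y ^ k \<in> int_module.span (power y ` {..<k})"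
    using algebraic_int_power_in_span[OF assms(2)] by blast
  define S where "S = (\<lambda>(i, j). x ^ i * y ^ j) ` ({..<n} \<times> {..<k})"
  have inS: "x ^ i * y ^ j \<in> S" if "i < n" "j < k" for i j
    using that by (auto simp: S_def)
  have "x * s \<in> int_module.span S" if "s \<in> S" for s
  proof -
    obtain i j where ij: "i < n" "j < k" "s = x ^ i * y ^ j" using \<open>s \<in> S\<close> by (auto simp: S_def)
    show ?thesis
    proof (cases "Suc i < n")
      case True
      then show ?thesis using inS[OF True ij(2)] ij(3) by (simp add: int_module.span_base mult.assoc)
    next
      case False
      then have "n = Suc i" using ij(1) by simp
      then have "x * s = y ^ j * x ^ n" by (simp add: ij(3))
      moreover have "y ^ j * x ^ i' \<in> S" if "i' < n" for i'
        using inS[OF that ij(2)] by (simp add: mult.commute)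
      then have "y ^ j * s' \<in> int_module.span S" if "s' \<in> power x ` {..<n}" for s'
        using that by (auto intro: int_module.span_base)
      ultimately show ?thesis using int_span_mult_left[OF _ n(2)] by simp
    qed
  qed
  moreover have "y * s \<in> int_module.span S" if "s \<in> S" for s
  proof -
    obtain i j where ij: "i < n" "j < k" "s = x ^ i * y ^ j" using \<open>s \<in> S\<close> by (auto simp: S_def)
    show ?thesis
    proof (cases "Suc j < k")
      case True
      then show ?thesis using inS[OF ij(1) True] ij(3) by (simp add: int_module.span_base mult.left_commute)
    next
      case False
      then have "k = Suc j" using ij(2) by simp
      then have "y * s = x ^ i * y ^ k" by (simp add: ij(3))
      moreover have "x ^ i * s' \<in> int_module.span S" if "s' \<in> power y ` {..<k}" for s'
        using that inS[OF ij(1)] by (auto intro: int_module.span_base)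
      ultimately show ?thesis using int_span_mult_left[OF _ k(2)] by simp
    qed
  qed
  ultimately show ?thesis
    using that[of S] inS[of 0 0] n(1) k(1) by (auto simp: S_def)
qed

lemma algebraic_int_add:
  fixes x y :: complex
  assumes "algebraic_int x" "algebraic_int y"
  shows "algebraic_int (x + y)"
proof -
  obtain S where S: "finite S" "1 \<in> S" "\<And>s. s \<in> S \<Longrightarrow> x * s \<in> int_module.span S"
    "\<And>s. s \<in> S \<Longrightarrow> y * s \<in> int_module.span S"
    using algebraic_int_common_span[OF assms] by blast
  then have "(x + y) * s \<in> int_module.span S" if "s \<in> S" for s
    using that by (simp add: distrib_right int_module.span_add)
  then show ?thesis using algebraic_int_if_span_stable[OF S(1,2)] by blast
qed

lemma algebraic_int_mult:
  fixes x y :: complex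
  assumes "algebraic_int x" "algebraic_int y"
  shows "algebraic_int (x * y)"
proof -
  obtain S where S: "finite S" "1 \<in> S" "\<And>s. s \<in> S \<Longrightarrow> x * s \<in> int_module.span S"
    "\<And>s. s \<in> S \<Longrightarrow> y * s \<in> int_module.span S"
    using algebraic_int_common_span[OF assms] by blast
  then have "x * y * s \<in> int_module.span S" if "s \<in> S" for s
    unfolding mult.assoc using that int_span_mult_left[OF S(3)] by blast
  then show ?thesis using algebraic_int_if_span_stable[OF S(1,2)] by blast
qed

lemma algebraic_int_diff:
  fixes x y :: complex
  shows "algebraic_int x \<Longrightarrow> algebraic_int y \<Longrightarrow> algebraic_int (x - y)"
  using algebraic_int_add[of x "- y"] by simp

lemma algebraic_int_power:
  fixes x :: complex
  shows "algebraic_int x \<Longrightarrow> algebraic_int (x ^ n)"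
  by (induction n) (auto intro: algebraic_int_mult)

lemma algebraic_int_of_power:
  fixes x :: complex
  assumes "algebraic_int (x ^ n)" "n > 0"
  shows "algebraic_int x"
  by (rule algebraic_int_root[OF assms(1), of "monom 1 n"])
     (use assms in \<open>auto simp: poly_monom degree_monom_eq\<close>)

lemma algebraic_int_sum:
  fixes f :: "'a \<Rightarrow> complex"
  shows "(\<And>i. i \<in> A \<Longrightarrow> algebraic_int (f i)) \<Longrightarrow> algebraic_int (sum f A)"
  by (induction A rule: infinite_finite_induct) (auto intro: algebraic_int_add)

section \<open>Embeddings and discriminants\<close>

lemma complex_field_simps [simp]:
  "carrier complex_field = UNIV" "x \<otimes>\<^bsub>complex_field\<^esub> y = x * y" "x \<oplus>\<^bsub>complex_field\<^esub> y = x + y"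
  "\<one>\<^bsub>complex_field\<^esub> = 1" "\<zero>\<^bsub>complex_field\<^esub> = 0"
  by (simp_all add: ring_of_type_algebra_def)

lemma complex_field_a_inv [simp]: "\<ominus>\<^bsub>complex_field\<^esub> x = - x"
  by (rule abelian_group.minus_equality[OF ring.is_abelian_group[OF ring_from_type_algebra]]) simp_all

lemma complex_field_m_inv: "x \<noteq> 0 \<Longrightarrow> inv\<^bsub>complex_field\<^esub> x = inverse x"
  by (rule comm_monoid.comm_inv_char[OF cring.axioms(2)[OF cring_from_type_algebra]]) simp_all

lemma subfield_complex_fieldD:
  assumes "subfield K complex_field"
  shows "0 \<in> K" "1 \<in> K" "x \<in> K \<Longrightarrow> y \<in> K \<Longrightarrow> x + y \<in> K" "x \<in> K \<Longrightarrow> y \<in> K \<Longrightarrow> x * y \<in> K"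
    "x \<in> K \<Longrightarrow> - x \<in> K" "x \<in> K \<Longrightarrow> inverse x \<in> K"
proof -
  have sr: "subring K complex_field" using assms by (rule subfieldE)
  from subringE[OF sr] show *: "0 \<in> K" "1 \<in> K" "x \<in> K \<Longrightarrow> y \<in> K \<Longrightarrow> x + y \<in> K"
    "x \<in> K \<Longrightarrow> y \<in> K \<Longrightarrow> x * y \<in> K" "x \<in> K \<Longrightarrow> - x \<in> K" by simp_all
  show "x \<in> K \<Longrightarrow> inverse x \<in> K"
    \<comment> \<open>For \<open>x = 0\<close> the convention \<open>inverse 0 = 0\<close> settles
      the claim.\<close>
    using ring.subfield_m_inv(1)[OF ring_from_type_algebra assms, of x] *(1) complex_field_m_inv[of x]
    by (cases "x = 0") auto
qed

lemma subfield_complex_of_nat: "subfield K complex_field \<Longrightarrow> of_nat n \<in> K"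
  by (induction n) (auto intro: subfield_complex_fieldD)

lemma subfield_complex_of_int: "subfield K complex_field \<Longrightarrow> of_int k \<in> K"
  by (cases k rule: int_cases2) (auto intro: subfield_complex_fieldD subfield_complex_of_nat)

lemma subfield_complex_of_rat: "subfield K complex_field \<Longrightarrow> of_rat q \<in> K"
  by (cases q) (auto simp: of_rat_rat divide_inverse
      intro!: subfield_complex_fieldD subfield_complex_of_int)

lemma subfield_complex_sum:
  "subfield K complex_field \<Longrightarrow> (\<And>i. i \<in> A \<Longrightarrow> f i \<in> K) \<Longrightarrow> sum f A \<in> K"
  by (induction A rule: infinite_finite_induct) (auto intro: subfield_complex_fieldD)

lemma embeddingsD:
  assumes "\<sigma> \<in> embeddings K"
  shows "x \<in> K \<Longrightarrow> y \<in> K \<Longrightarrow> \<sigma> (x + y) = \<sigma> x + \<sigma> y"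
    "x \<in> K \<Longrightarrow> y \<in> K \<Longrightarrow> \<sigma> (x * y) = \<sigma> x * \<sigma> y" "\<sigma> 1 = 1" "\<sigma> \<in> extensional K"
  using assms by (auto simp: embeddings_def Ring.ring_hom_def ring_of_type_algebra_def)

lemma embeddings_0:
  assumes "subfield K complex_field" "\<sigma> \<in> embeddings K"
  shows "\<sigma> 0 = 0"
  using embeddingsD(1)[OF assms(2), of 0 0] subfield_complex_fieldD(1)[OF assms(1)] by simp

lemma embeddings_uminus:
  assumes "subfield K complex_field" "\<sigma> \<in> embeddings K" "x \<in> K"
  shows "\<sigma> (- x) = - \<sigma> x"
  using embeddingsD(1)[OF assms(2), of x "- x"] subfield_complex_fieldD(5)[OF assms(1,3)]
    embeddings_0[OF assms(1,2)] assms(3) by (simp add: add_eq_0_iff)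

lemma embeddings_of_nat:
  assumes "subfield K complex_field" "\<sigma> \<in> embeddings K"
  shows "\<sigma> (of_nat n) = of_nat n"
  using assms
  by (induction n)
     (auto simp: embeddings_0 embeddingsD subfield_complex_fieldD subfield_complex_of_nat)

lemma embeddings_of_int:
  assumes "subfield K complex_field" "\<sigma> \<in> embeddings K"
  shows "\<sigma> (of_int k) = of_int k"
  using assms
  by (cases k rule: int_cases2)
     (auto simp: embeddings_uminus embeddings_of_nat subfield_complex_of_nat)

lemma embeddings_of_rat:
  assumes "subfield K complex_field" "\<sigma> \<in> embeddings K"
  shows "\<sigma> (of_rat q) = of_rat q"
proof -
  obtain a b where q: "q = Rat.Fract a b" "b > 0" by (cases q)
  then have eq: "of_int b * of_rat q = (of_int a :: complex)" by (simp add: of_rat_rat)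
  have "of_int b * \<sigma> (of_rat q) = \<sigma> (of_int b * of_rat q)"
    using assms by (simp add: embeddingsD embeddings_of_int subfield_complex_of_int subfield_complex_of_rat)
  also have "\<dots> = of_int b * of_rat q"
    unfolding eq using assms by (simp add: embeddings_of_int)
  finally show ?thesis using q(2) by simp
qed

lemma embeddings_sum:
  assumes "subfield K complex_field" "\<sigma> \<in> embeddings K" "\<And>i. i \<in> A \<Longrightarrow> f i \<in> K"
  shows "\<sigma> (sum f A) = (\<Sum>i\<in>A. \<sigma> (f i))"
  using assms
  by (induction A rule: infinite_finite_induct)
     (simp_all add: embeddings_0 embeddingsD subfield_complex_sum)

section \<open>Trace form, change of basis and uniqueness of the discriminant\<close>

lemma field_trace_sum:
  assumes K: "subfield K complex_field" and x: "\<And>i. i \<in> A \<Longrightarrow> x i \<in> K"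
  shows "field_trace K (\<Sum>i\<in>A. of_rat (q i) * x i) = (\<Sum>i\<in>A. of_rat (q i) * field_trace K (x i))"
proof -
  have "\<sigma> (\<Sum>i\<in>A. of_rat (q i) * x i) = (\<Sum>i\<in>A. of_rat (q i) * \<sigma> (x i))" if "\<sigma> \<in> embeddings K" for \<sigma>
    using K x that
    by (simp add: embeddings_sum embeddingsD embeddings_of_rat subfield_complex_of_rat
        subfield_complex_fieldD)
  then have "field_trace K (\<Sum>i\<in>A. of_rat (q i) * x i) =
      (\<Sum>\<sigma>\<in>embeddings K. \<Sum>i\<in>A. of_rat (q i) * \<sigma> (x i))"
    by (simp add: field_trace_def)
  also have "\<dots> = (\<Sum>i\<in>A. \<Sum>\<sigma>\<in>embeddings K. of_rat (q i) * \<sigma> (x i))"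
    by (rule sum.swap)
  finally show ?thesis by (simp add: field_trace_def sum_distrib_left)
qed

text \<open>The trace form is bilinear over the rationals, so its matrices are related by
  \<open>Tc = p * (Tb * transpose_mat p)\<close>. Entries are rational because the form is computed
  on monomials, which need not be an integral basis.\<close>

lemma basis_discriminant_change:
  assumes K: "subfield K complex_field" and bs: "set bs \<subseteq> K" and len: "length cs = length bs"
    and cs: "\<And>i. i < length bs \<Longrightarrow> cs ! i = (\<Sum>j<length bs. of_rat (P i j) * bs ! j)"
  shows "basis_discriminant K cs =
    (Determinant.det (Matrix.mat (length bs) (length bs) (\<lambda>(i, j). of_rat (P i j))))\<^sup>2 * basis_discriminant K bs"
proof -
  define n where "n = length bs"
  define p where "p = (Matrix.mat n n (\<lambda>(i, j). of_rat (P i j)) :: complex Matrix.mat)"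
  define Tb where "Tb = Matrix.mat n n (\<lambda>(i, j). field_trace K (bs ! i * bs ! j))"
  define Tc where "Tc = Matrix.mat n n (\<lambda>(i, j). field_trace K (cs ! i * cs ! j))"
  have bK: "bs ! i \<in> K" if "i < n" for i using bs that by (auto simp: n_def)
  have cK: "cs ! i \<in> K" if "i < n" for i
    using that bK unfolding n_def cs[OF that[unfolded n_def]]
    by (intro subfield_complex_sum[OF K] subfield_complex_fieldD(4)[OF K] subfield_complex_of_rat[OF K]) auto
  have carrier: "p \<in> carrier_mat n n" "Tb \<in> carrier_mat n n" "Tc \<in> carrier_mat n n"
    by (auto simp: p_def Tb_def Tc_def)
  have tr: "field_trace K (cs ! i * cs ! j) =
      (\<Sum>k<n. of_rat (P i k) * (\<Sum>l<n. of_rat (P j l) * field_trace K (bs ! k * bs ! l)))"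
    if "i < n" "j < n" for i j
  proof -
    have "cs ! i * cs ! j = (\<Sum>k<n. of_rat (P i k) * (bs ! k * cs ! j))"
      using cs that by (simp add: n_def sum_distrib_right mult.assoc)
    then have "field_trace K (cs ! i * cs ! j) = (\<Sum>k<n. of_rat (P i k) * field_trace K (bs ! k * cs ! j))"
      using field_trace_sum[OF K, of "{..<n}" "\<lambda>k. bs ! k * cs ! j" "P i"]
        subfield_complex_fieldD(4)[OF K] bK cK that by simp
    also have "\<dots> = (\<Sum>k<n. of_rat (P i k) * (\<Sum>l<n. of_rat (P j l) * field_trace K (bs ! k * bs ! l)))"
    proof (intro sum.cong refl arg_cong2[where f = "(*)"])
      fix k assume "k \<in> {..<n}"
      have "bs ! k * cs ! j = (\<Sum>l<n. of_rat (P j l) * (bs ! k * bs ! l))"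
        using cs that by (simp add: n_def sum_distrib_left mult.left_commute)
      then show "field_trace K (bs ! k * cs ! j) = (\<Sum>l<n. of_rat (P j l) * field_trace K (bs ! k * bs ! l))"
        using field_trace_sum[OF K, of "{..<n}" "\<lambda>l. bs ! k * bs ! l" "P j"]
          subfield_complex_fieldD(4)[OF K] bK \<open>k \<in> {..<n}\<close> by simp
    qed
    finally show ?thesis .
  qed
  have "Tc = p * (Tb * transpose_mat p)"
  proof (rule eq_matI)
    fix i j assume "i < dim_row (p * (Tb * transpose_mat p))" "j < dim_col (p * (Tb * transpose_mat p))"
    then have ij: "i < n" "j < n" using carrier by auto
    have "(Tb * transpose_mat p) $$ (k, j) = (\<Sum>l<n. of_rat (P j l) * field_trace K (bs ! k * bs ! l))"
      if "k < n" for k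
      using that ij by (simp add: Tb_def p_def scalar_prod_def atLeast0LessThan mult.commute)
    then have "(p * (Tb * transpose_mat p)) $$ (i, j) =
        (\<Sum>k<n. of_rat (P i k) * (\<Sum>l<n. of_rat (P j l) * field_trace K (bs ! k * bs ! l)))"
      using ij carrier by (simp add: scalar_prod_def atLeast0LessThan) (simp add: p_def)
    then show "Tc $$ (i, j) = (p * (Tb * transpose_mat p)) $$ (i, j)"
      using tr ij by (simp add: Tc_def)
  qed (use carrier in auto)
  then have "Determinant.det Tc = Determinant.det p * (Determinant.det Tb * Determinant.det p)"
    using carrier by (simp add: det_mult[of _ n] det_transpose)
  then show ?thesis
    unfolding basis_discriminant_def len
    by (simp add: Tc_def Tb_def p_def n_def power2_eq_square mult_ac)
qed


lemma integral_basis_coordinates: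
  assumes "integral_basis K bs" "(\<Sum>j<length bs. of_int (c j) * bs ! j) = (\<Sum>j<length bs. of_int (d j) * bs ! j)"
    and "j < length bs"
  shows "c j = d j"
proof -
  have "(\<Sum>j<length bs. of_int (c j - d j) * bs ! j) = 0"
    using assms(2) by (simp add: left_diff_distrib sum_subtractf)
  then show ?thesis
    using assms(1,3) distinct_independent_iff[of bs] unfolding integral_basis_def
    by (metis eq_iff_diff_eq_0)
qed

lemma integral_basis_transition:
  assumes "integral_basis K bs" "integral_basis K cs"
  obtains P where "\<And>i. i < length cs \<Longrightarrow> cs ! i = (\<Sum>j<length bs. of_int (P i j) * bs ! j)"
proof -
  have "\<exists>p. cs ! i = (\<Sum>j<length bs. of_int (p j) * bs ! j)" if "i < length cs" for i
  proof -
    have "cs ! i \<in> int_module.span (set cs)" using that by (simp add: int_module.span_base)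
    also have "\<dots> = int_module.span (set bs)" using assms by (simp add: integral_basis_def)
    finally show ?thesis unfolding span_set_list by blast
  qed
  then show ?thesis using that by metis
qed

text \<open>Substituting one expansion into the other expresses \<open>bs ! k\<close> through
  \<open>bs\<close> itself, where coordinates are unique.\<close>

lemma integral_basis_transition_inverse:
  assumes bs: "integral_basis K bs"
    and P: "\<And>i. i < length cs \<Longrightarrow> cs ! i = (\<Sum>j<length bs. of_int (P i j) * bs ! j)"
    and Q: "\<And>i. i < length bs \<Longrightarrow> bs ! i = (\<Sum>j<length cs. of_int (Q i j) * cs ! j)"
    and kj: "k < length bs" "j < length bs"
  shows "(\<Sum>i<length cs. Q k i * P i j) = (if j = k then 1 else 0)"
proof (rule integral_basis_coordinates[OF bs _ kj(2)])
  have "(\<Sum>j<length bs. of_int (\<Sum>i<length cs. Q k i * P i j) * bs ! j) =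
      (\<Sum>j<length bs. \<Sum>i<length cs. of_int (Q k i) * (of_int (P i j) * bs ! j))"
    by (simp add: sum_distrib_right mult.assoc)
  also have "\<dots> = (\<Sum>i<length cs. \<Sum>j<length bs. of_int (Q k i) * (of_int (P i j) * bs ! j))"
    by (rule sum.swap)
  also have "\<dots> = (\<Sum>i<length cs. of_int (Q k i) * cs ! i)"
    by (intro sum.cong refl) (simp add: P sum_distrib_left)
  also have "\<dots> = bs ! k"
    using Q[OF kj(1)] by (rule sym)
  also have "\<dots> = (\<Sum>j<length bs. if j = k then bs ! j else 0)"
    using kj(1) by simp
  also have "\<dots> = (\<Sum>j<length bs. of_int (if j = k then 1 else 0) * bs ! j)"
    by (intro sum.cong) auto
  finally show "(\<Sum>j<length bs. of_int (\<Sum>i<length cs. Q k i * P i j) * bs ! j) =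
      (\<Sum>j<length bs. of_int (if j = k then 1 else 0) * bs ! j)" .
qed

text \<open>The two transition matrices are inverse to each other; comparing the traces of their two
  products shows that they are square.\<close>

lemma integral_basis_discriminant_unique:
  assumes K: "subfield K complex_field" and bs: "integral_basis K bs" and cs: "integral_basis K cs"
  shows "basis_discriminant K cs = basis_discriminant K bs"
proof -
  obtain P where P: "\<And>i. i < length cs \<Longrightarrow> cs ! i = (\<Sum>j<length bs. of_int (P i j) * bs ! j)"
    using integral_basis_transition[OF bs cs] by blast
  obtain Q where Q: "\<And>i. i < length bs \<Longrightarrow> bs ! i = (\<Sum>j<length cs. of_int (Q i j) * cs ! j)"
    using integral_basis_transition[OF cs bs] by blast
  note QP = integral_basis_transition_inverse[OF bs P Q]
  note PQ = integral_basis_transition_inverse[OF cs Q P]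
  have "int (length bs) = (\<Sum>k<length bs. \<Sum>i<length cs. Q k i * P i k)"
    by (simp add: QP)
  also have "\<dots> = (\<Sum>i<length cs. \<Sum>k<length bs. P i k * Q k i)"
    by (subst sum.swap) (simp add: mult.commute)
  also have "\<dots> = int (length cs)"
    by (simp add: PQ)
  finally have len: "length cs = length bs" by simp
  define n where "n = length bs"
  define p where "p = Matrix.mat n n (\<lambda>(i, j). P i j)"
  define q where "q = Matrix.mat n n (\<lambda>(i, j). Q i j)"
  have "q * p = 1\<^sub>m n"
    using QP len
    by (intro eq_matI) (auto simp: p_def q_def n_def scalar_prod_def atLeast0LessThan)
  then have "Determinant.det q * Determinant.det p = 1"
    using det_mult[of q n p] by (simp add: p_def q_def)
  then have det: "(Determinant.det p)\<^sup>2 = 1"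
    by (auto simp: zmult_eq_1_iff)
  have "Matrix.mat n n (\<lambda>(i, j). of_rat (of_int (P i j))) = (of_int_hom.mat_hom p :: complex mat)"
    by (rule eq_matI) (auto simp: p_def)
  moreover have "set bs \<subseteq> K"
    using bs int_module.span_superset[of "set bs"]
    by (auto simp: integral_basis_def ring_of_integers_def)
  ultimately have "basis_discriminant K cs = (of_int (Determinant.det p))\<^sup>2 * basis_discriminant K bs"
    using basis_discriminant_change[OF K _ len, of "\<lambda>i j. of_int (P i j)"] P len
    by (simp add: n_def)
  then show ?thesis using det by (metis mult_1 of_int_1 of_int_power)
qed

lemma field_discriminant_eqI:
  assumes "subfield K complex_field" "integral_basis K bs" "basis_discriminant K bs = of_int d"
  shows "field_discriminant K = d"
  unfolding field_discriminant_def
proof (rule the_equality)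
  show "\<exists>bs. integral_basis K bs \<and> of_int d = basis_discriminant K bs"
    using assms by auto
next
  fix e assume "\<exists>bs. integral_basis K bs \<and> of_int e = basis_discriminant K bs"
  then obtain cs where "integral_basis K cs" "of_int e = basis_discriminant K cs" by blast
  then have "(of_int e :: complex) = of_int d"
    using integral_basis_discriminant_unique[OF assms(1,2)] assms(3) by simp
  then show "e = d" by simp
qed

lemma embeddings_power:
  assumes "subfield K complex_field" "\<sigma> \<in> embeddings K" "x \<in> K"
  shows "x ^ n \<in> K \<and> \<sigma> (x ^ n) = \<sigma> x ^ n"
  using assms by (induction n) (auto simp: embeddingsD subfield_complex_fieldD)

text \<open>An embedding fixes the integer coefficients, so \<open>\<sigma> x\<close> satisfies the
  same monic equation as \<open>x\<close>.\<close>

lemma embeddings_algebraic_int: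
  assumes K: "subfield K complex_field" and \<sigma>: "\<sigma> \<in> embeddings K" and x: "x \<in> K" "algebraic_int x"
  shows "algebraic_int (\<sigma> x)"
proof -
  obtain p where p: "poly (map_poly of_int p) x = 0" "lead_coeff p = 1"
    using x(2) by (auto simp: algebraic_int_altdef_ipoly)
  have "poly (map_poly of_int p) (\<sigma> x) = (\<Sum>i\<le>degree p. of_int (coeff p i) * \<sigma> x ^ i)"
    by (simp add: poly_altdef coeff_map_poly degree_map_poly)
  also have "\<dots> = \<sigma> (\<Sum>i\<le>degree p. of_int (coeff p i) * x ^ i)"
    using embeddings_power[OF K \<sigma> x(1)] K \<sigma>
    by (simp add: embeddings_sum embeddingsD embeddings_of_int subfield_complex_fieldD subfield_complex_of_int)
  also have "(\<Sum>i\<le>degree p. of_int (coeff p i) * x ^ i) = 0"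
    using p(1) by (simp add: poly_altdef coeff_map_poly degree_map_poly)
  finally show ?thesis using p(2) embeddings_0[OF K \<sigma>] unfolding algebraic_int_altdef_ipoly by auto
qed

section \<open>Gaussian rationals and Gaussian integers\<close>

definition gauss_rats :: "complex set" where
  "gauss_rats = {z. Re z \<in> \<rat> \<and> Im z \<in> \<rat>}"

definition gauss_ints :: "complex set" where
  "gauss_ints = {z. Re z \<in> \<int> \<and> Im z \<in> \<int>}"

lemma gauss_rats_closed [intro, simp]:
  "0 \<in> gauss_rats" "1 \<in> gauss_rats" "\<i> \<in> gauss_rats" "of_nat n \<in> gauss_rats" "of_int k \<in> gauss_rats"
  "numeral l \<in> gauss_rats"
  "x \<in> gauss_rats \<Longrightarrow> y \<in> gauss_rats \<Longrightarrow> x + y \<in> gauss_rats"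
  "x \<in> gauss_rats \<Longrightarrow> y \<in> gauss_rats \<Longrightarrow> x - y \<in> gauss_rats"
  "x \<in> gauss_rats \<Longrightarrow> y \<in> gauss_rats \<Longrightarrow> x * y \<in> gauss_rats"
  "x \<in> gauss_rats \<Longrightarrow> - x \<in> gauss_rats"
  "x \<in> gauss_rats \<Longrightarrow> inverse x \<in> gauss_rats"
  "x \<in> gauss_rats \<Longrightarrow> y \<in> gauss_rats \<Longrightarrow> x / y \<in> gauss_rats"
  "x \<in> gauss_rats \<Longrightarrow> x ^ n \<in> gauss_rats"
proof -
  show *: "1 \<in> gauss_rats" and mult: "x \<in> gauss_rats \<Longrightarrow> y \<in> gauss_rats \<Longrightarrow> x * y \<in> gauss_rats" for x y
    by (auto simp: gauss_rats_def)
  show inv: "x \<in> gauss_rats \<Longrightarrow> inverse x \<in> gauss_rats" for x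
    by (auto simp: gauss_rats_def)
  show "x \<in> gauss_rats \<Longrightarrow> y \<in> gauss_rats \<Longrightarrow> x / y \<in> gauss_rats"
    unfolding divide_inverse by (intro mult inv)
  show "x \<in> gauss_rats \<Longrightarrow> x ^ n \<in> gauss_rats"
    by (induction n) (auto intro: * mult)
qed (auto simp: gauss_rats_def)

lemma gauss_ints_closed [intro, simp]:
  "0 \<in> gauss_ints" "1 \<in> gauss_ints" "\<i> \<in> gauss_ints" "of_nat n \<in> gauss_ints" "of_int k \<in> gauss_ints"
  "numeral l \<in> gauss_ints"
  "x \<in> gauss_ints \<Longrightarrow> y \<in> gauss_ints \<Longrightarrow> x + y \<in> gauss_ints"
  "x \<in> gauss_ints \<Longrightarrow> y \<in> gauss_ints \<Longrightarrow> x - y \<in> gauss_ints"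
  "x \<in> gauss_ints \<Longrightarrow> y \<in> gauss_ints \<Longrightarrow> x * y \<in> gauss_ints"
  "x \<in> gauss_ints \<Longrightarrow> - x \<in> gauss_ints"
  by (auto simp: gauss_ints_def)

lemma gauss_intsE:
  assumes "z \<in> gauss_ints"
  obtains a b where "z = of_int a + \<i> * of_int b"
  using assms that unfolding gauss_ints_def by (auto simp: complex_eq_iff elim!: Ints_cases)

lemma complex_of_rat_eq: "(of_rat q :: complex) = of_real (of_rat q)"
  by (cases q) (simp add: of_rat_rat)

lemma gauss_ratsE:
  assumes "z \<in> gauss_rats"
  obtains p q where "z = of_rat p + \<i> * of_rat q"
proof -
  obtain p q where "Re z = of_rat p" "Im z = of_rat q"
    using assms unfolding gauss_rats_def by (auto elim!: Rats_cases)
  then have "z = of_rat p + \<i> * of_rat q"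
    by (simp add: complex_eq_iff complex_of_rat_eq)
  then show ?thesis by (rule that)
qed

lemma gauss_ints_algebraic_int: "z \<in> gauss_ints \<Longrightarrow> algebraic_int z"
  by (elim gauss_intsE) (auto intro!: algebraic_int_add algebraic_int_mult)

text \<open>The traces of \<open>z\<close> and \<open>- \<i> * z\<close> make
  \<open>2 * Re z\<close> and \<open>2 * Im z\<close> integers \<open>a\<close> and
  \<open>b\<close>, and the norm gives \<open>a^2 + b^2 = 4 * n\<close>. Two odd squares add up to 2
  modulo 4, so \<open>a\<close> and \<open>b\<close> are even.\<close>

lemma algebraic_int_gauss_rats:
  assumes z: "z \<in> gauss_rats" and int: "algebraic_int z"
  shows "z \<in> gauss_ints"
proof -
  have trace: "2 * Re w \<in> \<int>" if w: "w \<in> gauss_rats" "algebraic_int w" for w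
  proof -
    have "algebraic_int (w + cnj w)" using w by (intro algebraic_int_add) auto
    then have "algebraic_int (2 * Re w)" unfolding complex_add_cnj algebraic_int_of_real_iff .
    then show ?thesis using w by (intro rational_algebraic_int_is_int) (auto simp: gauss_rats_def)
  qed
  have "algebraic_int (z * cnj z)" using int by (intro algebraic_int_mult) auto
  then have "algebraic_int ((Re z)\<^sup>2 + (Im z)\<^sup>2)" unfolding complex_mult_cnj algebraic_int_of_real_iff .
  then have "(Re z)\<^sup>2 + (Im z)\<^sup>2 \<in> \<int>"
    using z by (intro rational_algebraic_int_is_int) (auto simp: gauss_rats_def)
  then obtain n where n: "(Re z)\<^sup>2 + (Im z)\<^sup>2 = of_int n" by (elim Ints_cases)
  obtain a where a: "2 * Re z = of_int a" using trace[OF assms] by (elim Ints_cases)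
  have "2 * Re (- \<i> * z) \<in> \<int>"
    using assms by (intro trace) (auto intro: algebraic_int_mult)
  then obtain b where b: "2 * Im z = of_int b" by (auto elim: Ints_cases)
  have "real_of_int (a\<^sup>2 + b\<^sup>2) = of_int (4 * n)"
    using n unfolding of_int_add of_int_power a[symmetric] b[symmetric] by (simp add: power2_eq_square)
  then have ab: "a\<^sup>2 + b\<^sup>2 = 4 * n" by linarith
  have "even a \<and> even b"
  proof (rule ccontr)
    assume "\<not> (even a \<and> even b)"
    moreover have "even (a\<^sup>2 + b\<^sup>2)" unfolding ab by simp
    then have "even a \<longleftrightarrow> even b" by simp
    ultimately obtain u v where "a = 2 * u + 1" "b = 2 * v + 1" by (auto elim!: oddE)
    then have "4 * (u\<^sup>2 + u + v\<^sup>2 + v) + 2 = 4 * n" using ab by (simp add: power2_eq_square algebra_simps)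
    then show False by presburger
  qed
  then obtain u v where "a = 2 * u" "b = 2 * v" by (auto elim!: evenE)
  with a b have "Re z = of_int u" "Im z = of_int v" by simp_all
  then show ?thesis by (simp add: gauss_ints_def)
qed

text \<open>The fourth power of a prime in the denominator of \<open>r\<close> would divide
  \<open>m ^ k\<close>, but that prime divides the square-free \<open>m\<close> only once, and
  \<open>k \<le> 3\<close>.\<close>

lemma rat_int_if_power_mult_int:
  fixes r :: rat
  assumes "squarefree m" "k \<le> 3" "r ^ 4 * of_nat m ^ k \<in> \<int>"
  shows "r \<in> \<int>"
proof -
  obtain s t where r: "r = Rat.Fract s t" "t > 0" "Rings.coprime s t" by (cases r)
  then have r': "r = of_int s / of_int t" by (simp add: Fract_of_int_quotient)
  obtain n where "r ^ 4 * of_nat m ^ k = of_int n" using assms(3) by (elim Ints_cases)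
  then have "rat_of_int (s ^ 4 * int m ^ k) = of_int (n * t ^ 4)"
    using r(2) by (simp add: r' field_simps)
  then have "s ^ 4 * int m ^ k = n * t ^ 4" by linarith
  then have "t ^ 4 dvd s ^ 4 * int m ^ k" by simp
  moreover have "Rings.coprime (t ^ 4) (s ^ 4)" using r(3) by (simp add: coprime_commute)
  ultimately have dvd: "t ^ 4 dvd int m ^ k" by (simp add: coprime_dvd_mult_right_iff)
  have "t = 1"
  proof (rule ccontr)
    assume "t \<noteq> 1"
    then obtain p where p: "prime p" "p dvd t"
      using r(2) prime_divisor_exists[of t] by auto
    then have p4: "p ^ 4 dvd int m ^ k" using dvd dvd_power_same dvd_trans by blast
    then have "p dvd int m ^ k" by (meson dvd_power dvd_trans zero_less_numeral)
    then have "p dvd int m" using p(1) prime_dvd_power by blast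
    then obtain u where u: "int m = p * u" by (elim dvdE)
    have "\<not> p dvd u"
    proof
      assume "p dvd u"
      then have "p ^ 2 dvd int m" by (simp add: u power2_eq_square)
      then have "nat p ^ 2 dvd m" using p(1) prime_ge_0_int[OF p(1)]
        by (metis int_dvd_int_iff int_nat_eq of_nat_power)
      then have "is_unit (nat p)" using assms(1) by (simp add: squarefree_def)
      then show False using prime_gt_1_int[OF p(1)] by simp
    qed
    have "p ^ k * p ^ (4 - k) dvd p ^ k * u ^ k"
      using p4 assms(2) by (simp add: u power_mult_distrib flip: power_add)
    then have "p ^ (4 - k) dvd u ^ k" using prime_gt_1_int[OF p(1)] by simp
    moreover have "p dvd p ^ (4 - k)" using assms(2) by simp
    ultimately have "p dvd u" using p(1) prime_dvd_power dvd_trans by blast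
    with \<open>\<not> p dvd u\<close> show False by simp
  qed
  then show ?thesis by (simp add: r')
qed

section \<open>Elements written as cubics in a fourth root of \<open>m\<close>\<close>

definition gev :: "complex \<Rightarrow> complex \<Rightarrow> complex \<Rightarrow> complex \<Rightarrow> complex \<Rightarrow> complex" where
  "gev T a b c d = a + b * T + c * T ^ 2 + d * T ^ 3"

lemma gev_add: "gev T a b c d + gev T a' b' c' d' = gev T (a + a') (b + b') (c + c') (d + d')"
  by (simp add: gev_def algebra_simps)

lemma gev_uminus: "- gev T a b c d = gev T (- a) (- b) (- c) (- d)"
  by (simp add: gev_def)

lemma gev_mult:
  assumes "T ^ 4 = M"
  shows "gev T a b c d * gev T a' b' c' d' =
    gev T (a * a' + M * (b * d' + c * c' + d * b')) (a * b' + b * a' + M * (c * d' + d * c'))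
      (a * c' + b * b' + c * a' + M * (d * d')) (a * d' + b * c' + c * b' + d * a')"
  unfolding gev_def assms[symmetric]
  by (simp add: algebra_simps power2_eq_square power3_eq_cube power4_eq_xxxx)

text \<open>For \<open>I\<close> equal to \<i> or \<open>- \<i>\<close> this is the identity or
  complex conjugation; the uniform formula lets the embeddings be indexed by pairs
  \<open>(I, T)\<close> of images of \<i> and \<theta>.\<close>

definition gconj :: "complex \<Rightarrow> complex \<Rightarrow> complex" where
  "gconj I z = of_real (Re z) + I * of_real (Im z)"

lemma gconj_simps:
  assumes "I ^ 2 = - 1"
  shows "gconj I (x + y) = gconj I x + gconj I y" "gconj I (x * y) = gconj I x * gconj I y"
    "gconj I (of_nat n) = of_nat n" "gconj I 1 = 1" "gconj I 0 = 0" "gconj I \<i> = I"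
proof -
  have I: "I * (I * w) = - w" for w
    using assms by (simp add: power2_eq_square flip: mult.assoc)
  show "gconj I (x * y) = gconj I x * gconj I y"
    by (simp add: gconj_def algebra_simps I)
qed (simp_all add: gconj_def algebra_simps)

lemma gconj_i [simp]: "gconj \<i> z = z" "gconj (- \<i>) z = cnj z"
  by (simp_all add: gconj_def complex_eq_iff)

locale quartic_field =
  fixes m :: nat and \<theta> :: complex
  assumes theta: "\<theta> ^ 4 = of_nat m" and nonsquare: "\<And>k :: nat. k\<^sup>2 \<noteq> m"
begin

text \<open>A root would be a Gaussian integer with parts \<open>a\<close>, \<open>b\<close> and
  \<open>a * b = 0\<close>, so \<open>m\<close> is \<open>a^2\<close> or \<open>- (b^2)\<close>; the
  latter forces \<open>m = 0\<close>, a square too.\<close>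

lemma gauss_rats_nonsquare:
  assumes "z \<in> gauss_rats"
  shows "z\<^sup>2 \<noteq> of_nat m"
proof
  assume z: "z\<^sup>2 = of_nat m"
  have "algebraic_int (z ^ 2)" unfolding z by simp
  then have "algebraic_int z" by (rule algebraic_int_of_power) simp
  then obtain a b where ab: "z = of_int a + \<i> * of_int b"
    using gauss_intsE[OF algebraic_int_gauss_rats[OF assms]] by blast
  have "a\<^sup>2 - b\<^sup>2 = int m" "a * b = 0"
  proof -
    have "real_of_int (a\<^sup>2 - b\<^sup>2) = of_int (int m)"
      using arg_cong[OF z, of Re] by (simp add: ab power2_eq_square)
    then show "a\<^sup>2 - b\<^sup>2 = int m" by linarith
    have "real_of_int (a * b) = 0"
      using arg_cong[OF z, of Im] by (simp add: ab power2_eq_square)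
    then show "a * b = 0" by linarith
  qed
  then have "int m = a\<^sup>2 \<or> int m = - (b\<^sup>2)" by auto
  then have "\<exists>c. int m = c\<^sup>2" by (metis neg_0_le_iff_le of_nat_0_le_iff order_antisym zero_eq_power2 zero_le_power2 minus_zero)
  then obtain c where "int m = c\<^sup>2" by blast
  then have "(nat \<bar>c\<bar>)\<^sup>2 = m" by (metis nat_int nat_power_eq abs_ge_zero power2_abs)
  then show False using nonsquare by blast
qed

text \<open>With \<open>s = T\<^sup>2\<close>, a relation between the powers of \<open>T\<close> either puts \<open>s\<close> into \<open>\<rat>(\<i>)\<close>, where \<open>s\<^sup>2 = m\<close>,
  or makes \<open>s\<close> a square in \<open>\<rat>(\<i>, s)\<close>; in the latter case \<open>- m\<close>, hence \<open>m\<close>, is a square in \<open>\<rat>(\<i>)\<close>.\<close>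

lemma gev_eq_0:
  assumes T: "T ^ 4 = of_nat m" and G: "a \<in> gauss_rats" "b \<in> gauss_rats" "c \<in> gauss_rats" "d \<in> gauss_rats"
    and eq: "gev T a b c d = 0"
  shows "a = 0 \<and> b = 0 \<and> c = 0 \<and> d = 0"
proof -
  define s where "s = T\<^sup>2"
  have s2: "s\<^sup>2 = of_nat m" using T by (simp add: s_def flip: power_mult)
  have lin: "p = 0 \<and> q = 0" if "p \<in> gauss_rats" "q \<in> gauss_rats" "p + q * s = 0" for p q
  proof (cases "q = 0")
    case False
    then have "s = - p / q" using that(3) by (simp add: field_simps eq_neg_iff_add_eq_0)
    then have "s \<in> gauss_rats" using that by simp
    then show ?thesis using gauss_rats_nonsquare s2 by blast
  qed (use that in simp)
  have eq': "(a + c * s) + (b + d * s) * T = 0"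
    using eq by (simp add: gev_def s_def power3_eq_cube power2_eq_square algebra_simps)
  have "b + d * s = 0"
  proof (rule ccontr)
    assume nz: "b + d * s \<noteq> 0"
    have nz': "b - d * s \<noteq> 0" using lin[of b "- d"] G nz by auto
    \<comment> \<open>\<open>N\<close> is the norm of \<open>b + d * s\<close> down to the Gaussian
      rationals; \<open>p\<close> and \<open>q\<close> are the coordinates of
      \<open>- (a + c * s) / (b + d * s)\<close> after rationalising with
      \<open>b - d * s\<close>.\<close>
    define N where "N = b\<^sup>2 - of_nat m * d\<^sup>2"
    have N: "N = (b + d * s) * (b - d * s)" by (simp add: N_def power2_eq_square algebra_simps flip: s2)
    have "N \<noteq> 0" using nz nz' by (simp add: N)
    define p where "p = - (a * b - of_nat m * c * d) / N"
    define q where "q = - (c * b - a * d) / N"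
    have pq: "p \<in> gauss_rats" "q \<in> gauss_rats" using G by (simp_all add: p_def q_def N_def)
    have "(b + d * s) * T = - (a + c * s)"
      using eq' by (simp only: add_eq_0_iff)
    then have "N * T = - (a + c * s) * (b - d * s)"
      unfolding N by (metis mult.assoc mult.commute)
    also have "\<dots> = N * (p + q * s)"
      using \<open>N \<noteq> 0\<close> unfolding p_def q_def s2[symmetric] by (simp add: field_simps power2_eq_square)
    finally have T: "T = p + q * s" using \<open>N \<noteq> 0\<close> by simp
    \<comment> \<open>Expanding \<open>(p + q * s)^2 = s\<close> and comparing coordinates gives
      \<open>p^2 + m * q^2 = 0\<close> and \<open>2 * p * q = 1\<close>.\<close>
    have "(p\<^sup>2 + of_nat m * q\<^sup>2) + (2 * p * q - 1) * s = T\<^sup>2 - s"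
      unfolding T s2[symmetric] by (simp add: power2_eq_square algebra_simps)
    then have "(p\<^sup>2 + of_nat m * q\<^sup>2) + (2 * p * q - 1) * s = 0" by (simp add: s_def)
    then have "p\<^sup>2 + of_nat m * q\<^sup>2 = 0 \<and> 2 * p * q - 1 = 0" using pq by (intro lin) auto
    then have *: "p\<^sup>2 = - of_nat m * q\<^sup>2" "2 * p * q = 1" by (auto simp: eq_neg_iff_add_eq_0)
    then have "q \<noteq> 0" by auto
    \<comment> \<open>Here \<open>p / q\<close> is a square root of \<open>- m\<close>; the factor
      \<i> turns it into one of \<open>m\<close>.\<close>
    then have "(\<i> * p / q)\<^sup>2 = of_nat m" using *(1) by (simp add: power_mult_distrib power_divide field_simps)
    then show False using gauss_rats_nonsquare pq by simp
  qed
  then show ?thesis using lin[of b d] lin[of a c] G eq' by simp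
qed

lemma gev_eq_iff:
  assumes T: "T ^ 4 = of_nat m" and G: "a \<in> gauss_rats" "b \<in> gauss_rats" "c \<in> gauss_rats" "d \<in> gauss_rats"
    "a' \<in> gauss_rats" "b' \<in> gauss_rats" "c' \<in> gauss_rats" "d' \<in> gauss_rats"
  shows "gev T a b c d = gev T a' b' c' d' \<longleftrightarrow> a = a' \<and> b = b' \<and> c = c' \<and> d = d'"
proof
  assume "gev T a b c d = gev T a' b' c' d'"
  then have "gev T (a - a') (b - b') (c - c') (d - d') = 0" by (simp add: gev_def algebra_simps)
  then show "a = a' \<and> b = b' \<and> c = c' \<and> d = d'"
    using gev_eq_0[OF T, of "a - a'" "b - b'" "c - c'" "d - d'"] G by simp
qed simp

lemma theta_neq_0: "\<theta> \<noteq> 0"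
  using theta nonsquare[of 0] by auto

end

section \<open>The field \<open>\<rat>(\<i>, \<theta>)\<close> and its embeddings\<close>

context quartic_field
begin

definition K :: "complex set" where
  "K = {gev \<theta> a b c d | a b c d.
     a \<in> gauss_rats \<and> b \<in> gauss_rats \<and> c \<in> gauss_rats \<and> d \<in> gauss_rats}"

lemma gev_in_K [intro]:
  "a \<in> gauss_rats \<Longrightarrow> b \<in> gauss_rats \<Longrightarrow> c \<in> gauss_rats \<Longrightarrow> d \<in> gauss_rats \<Longrightarrow> gev \<theta> a b c d \<in> K"
  unfolding K_def by blast

lemma K_E:
  assumes "x \<in> K"
  obtains a b c d where "x = gev \<theta> a b c d" "a \<in> gauss_rats" "b \<in> gauss_rats" "c \<in> gauss_rats" "d \<in> gauss_rats"
  using assms unfolding K_def by blast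

lemma K_mult: "x \<in> K \<Longrightarrow> y \<in> K \<Longrightarrow> x * y \<in> K"
  by (elim K_E) (auto simp: gev_mult[OF theta])

lemma gauss_rats_subset_K: "gauss_rats \<subseteq> K"
proof
  fix z assume "z \<in> gauss_rats"
  then show "z \<in> K" using gev_in_K[of z 0 0 0] by (simp add: gev_def)
qed

text \<open>The inverse is obtained from the two relative norms to \<open>\<rat>(\<i>, \<theta>\<^sup>2)\<close> and \<open>\<rat>(\<i>)\<close>.\<close>

lemma K_inverse:
  assumes "x \<in> K" "x \<noteq> 0"
  shows "inverse x \<in> K"
proof -
  obtain a b c d where x: "x = gev \<theta> a b c d"
    and G: "a \<in> gauss_rats" "b \<in> gauss_rats" "c \<in> gauss_rats" "d \<in> gauss_rats"
    using assms(1) by (rule K_E)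
  \<comment> \<open>\<open>y\<close> is the conjugate of \<open>x\<close> under \<theta> ->
    \<open>- \<theta>\<close>, and \<open>z\<close> that of \<open>x * y\<close> under
    \<open>\<theta>^2\<close> -> \<open>- \<theta>^2\<close>.\<close>
  define y where "y = gev \<theta> a (- b) c (- d)"
  define A where "A = a * a + of_nat m * (c * c - 2 * b * d)"
  define B where "B = 2 * a * c - b * b - of_nat m * (d * d)"
  define z where "z = gev \<theta> A 0 (- B) 0"
  define N where "N = A * A - of_nat m * (B * B)"
  have G': "A \<in> gauss_rats" "B \<in> gauss_rats" "N \<in> gauss_rats"
    using G by (auto simp: A_def B_def N_def)
  have xy: "x * y = gev \<theta> A 0 B 0"
    unfolding x y_def gev_mult[OF theta] by (simp add: A_def B_def algebra_simps)
  have xyz: "x * y * z = N"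
    unfolding xy z_def gev_mult[OF theta] by (simp add: N_def gev_def)
  have nz: "\<not> (a = 0 \<and> b = 0 \<and> c = 0 \<and> d = 0)"
    using assms(2) by (auto simp: x gev_def)
  then have "y \<noteq> 0"
    using gev_eq_0[OF theta, of a "- b" c "- d"] G by (auto simp: y_def)
  with assms(2) have "\<not> (A = 0 \<and> B = 0)"
    using xy by (auto simp: gev_def)
  then have "z \<noteq> 0"
    using gev_eq_0[OF theta, of A 0 "- B" 0] G' by (auto simp: z_def)
  with assms(2) \<open>y \<noteq> 0\<close> have "N \<noteq> 0" using xyz by auto
  then have "inverse x = y * z * inverse N"
    using xyz assms(2) by (simp add: field_simps)
  moreover have "y \<in> K" "z \<in> K" "inverse N \<in> K"
    using G G' gauss_rats_subset_K by (auto simp: y_def z_def)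
  ultimately show ?thesis by (simp add: K_mult)
qed

lemma rat_adjoin_subfield: "subfield (rat_adjoin S) complex_field"
  unfolding rat_adjoin_def by (rule field.generate_field_is_subfield[OF field_from_type_algebra]) simp

lemma rat_adjoin_eq: "rat_adjoin {\<i>, \<theta>} = K"
proof
  show "rat_adjoin {\<i>, \<theta>} \<subseteq> K"
  proof
    fix x assume "x \<in> rat_adjoin {\<i>, \<theta>}"
    then show "x \<in> K"
      unfolding rat_adjoin_def
    proof (induction rule: generate_field.induct)
      case one
      show ?case using gauss_rats_subset_K by auto
    next
      case (incl h)
      then show ?case
        using gauss_rats_subset_K gev_in_K[of 0 1 0 0] by (auto simp: gev_def)
    next
      case (a_inv h)
      then show ?case by (elim K_E) (auto simp: gev_uminus)
    next
      case (m_inv h)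
      then show ?case by (simp add: complex_field_m_inv K_inverse)
    next
      case (eng_add g h)
      then show ?case by (elim K_E) (auto simp: gev_add)
    next
      case (eng_mult g h)
      then show ?case by (simp add: K_mult)
    qed
  qed
next
  note F = subfield_complex_fieldD[OF rat_adjoin_subfield[of "{\<i>, \<theta>}"]]
  have gens: "\<i> \<in> rat_adjoin {\<i>, \<theta>}" "\<theta> \<in> rat_adjoin {\<i>, \<theta>}"
    by (auto simp: rat_adjoin_def intro: generate_field.incl)
  then have pow: "\<theta> ^ n \<in> rat_adjoin {\<i>, \<theta>}" for n
    by (induction n) (auto intro: F)
  have G: "z \<in> rat_adjoin {\<i>, \<theta>}" if "z \<in> gauss_rats" for z
  proof -
    obtain p q where "z = of_rat p + \<i> * of_rat q"
      using \<open>z \<in> gauss_rats\<close> by (rule gauss_ratsE)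
    then show ?thesis
      using gens subfield_complex_of_rat[OF rat_adjoin_subfield] by (simp add: F)
  qed
  show "K \<subseteq> rat_adjoin {\<i>, \<theta>}"
  proof
    fix x assume "x \<in> K"
    then obtain a b c d where "x = gev \<theta> a b c d"
      "a \<in> gauss_rats" "b \<in> gauss_rats" "c \<in> gauss_rats" "d \<in> gauss_rats" by (rule K_E)
    then show "x \<in> rat_adjoin {\<i>, \<theta>}"
      using gens(2) pow G by (simp add: gev_def F)
  qed
qed

lemma K_subfield: "subfield K complex_field"
  using rat_adjoin_subfield[of "{\<i>, \<theta>}"] by (simp add: rat_adjoin_eq)

section \<open>The eight embeddings and the trace\<close>

definition emb :: "complex \<Rightarrow> complex \<Rightarrow> complex \<Rightarrow> complex" where
  "emb I T = restrict (\<lambda>x. THE y. \<exists>a b c d.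
     a \<in> gauss_rats \<and> b \<in> gauss_rats \<and> c \<in> gauss_rats \<and> d \<in> gauss_rats \<and>
     x = gev \<theta> a b c d \<and> y = gev T (gconj I a) (gconj I b) (gconj I c) (gconj I d)) K"

text \<open>Uniqueness of coordinates makes the definite description in \<open>emb\<close>
  single-valued.\<close>

lemma emb_gev:
  assumes "a \<in> gauss_rats" "b \<in> gauss_rats" "c \<in> gauss_rats" "d \<in> gauss_rats"
  shows "emb I T (gev \<theta> a b c d) = gev T (gconj I a) (gconj I b) (gconj I c) (gconj I d)"
proof -
  have "gev \<theta> a b c d \<in> K" using assms by blast
  moreover have "(THE y. \<exists>a' b' c' d'.
     a' \<in> gauss_rats \<and> b' \<in> gauss_rats \<and> c' \<in> gauss_rats \<and> d' \<in> gauss_rats \<and>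
     gev \<theta> a b c d = gev \<theta> a' b' c' d' \<and> y = gev T (gconj I a') (gconj I b') (gconj I c') (gconj I d')) =
     gev T (gconj I a) (gconj I b) (gconj I c) (gconj I d)"
    using assms by (intro the_equality) (auto simp: gev_eq_iff[OF theta])
  ultimately show ?thesis by (simp add: emb_def)
qed

lemma emb_simps:
  assumes "I\<^sup>2 = - 1"
  shows "emb I T 1 = 1" "emb I T \<i> = I" "emb I T \<theta> = T"
  using emb_gev[of 1 0 0 0 I T] emb_gev[of \<i> 0 0 0 I T] emb_gev[of 0 1 0 0 I T]
  by (simp_all add: gev_def gconj_simps[OF assms])

text \<open>\<open>gev_mult\<close> uses only the fourth power of its base, and \<open>gconj\<close>
  is multiplicative as soon as \<open>I^2 = - 1\<close>, so coordinates of products are formed alike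
  on both sides.\<close>

lemma emb_embedding:
  assumes I: "I\<^sup>2 = - 1" and T: "T ^ 4 = of_nat m"
  shows "emb I T \<in> embeddings K"
proof -
  have "emb I T (x + y) = emb I T x + emb I T y \<and> emb I T (x * y) = emb I T x * emb I T y"
    if "x \<in> K" "y \<in> K" for x y
    using that
    by (elim K_E)
       (simp add: gev_add gev_mult[OF theta] gev_mult[OF T] emb_gev gconj_simps[OF I])
  then show ?thesis
    using emb_simps(1)[OF I, of T]
    by (auto simp: embeddings_def Ring.ring_hom_def ring_of_type_algebra_def emb_def)
qed

lemma embedding_gev:
  assumes \<sigma>: "\<sigma> \<in> embeddings K"
    and G: "a \<in> gauss_rats" "b \<in> gauss_rats" "c \<in> gauss_rats" "d \<in> gauss_rats"
  shows "\<sigma> (gev \<theta> a b c d) = gev (\<sigma> \<theta>) (gconj (\<sigma> \<i>) a) (gconj (\<sigma> \<i>) b) (gconj (\<sigma> \<i>) c) (gconj (\<sigma> \<i>) d)"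
proof -
  note F = subfield_complex_fieldD[OF K_subfield]
  have K: "\<i> \<in> K" "\<theta> \<in> K"
    using gauss_rats_subset_K gev_in_K[of 0 1 0 0] by (auto simp: gev_def)
  have conj: "\<sigma> z = gconj (\<sigma> \<i>) z" if "z \<in> gauss_rats" for z
  proof -
    obtain p q where z: "z = of_rat p + \<i> * of_rat q"
      using \<open>z \<in> gauss_rats\<close> by (rule gauss_ratsE)
    then have "\<sigma> z = of_rat p + \<sigma> \<i> * of_rat q"
      using K by (simp add: embeddingsD[OF \<sigma>] embeddings_of_rat[OF K_subfield \<sigma>] F
          subfield_complex_of_rat[OF K_subfield])
    then show ?thesis by (simp add: gconj_def z complex_of_rat_eq)
  qed
  have "z \<in> K" if "z \<in> gauss_rats" for z using that gauss_rats_subset_K by blast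
  then show ?thesis
    using embeddings_power[OF K_subfield \<sigma> K(2)] G K
    by (simp add: gev_def embeddingsD[OF \<sigma>] F flip: conj)
qed

definition roots :: "complex set" where
  "roots = {\<theta>, \<i> * \<theta>, - \<theta>, - \<i> * \<theta>}"

lemma rootsI:
  assumes "T ^ 4 = of_nat m"
  shows "T \<in> roots"
proof -
  have "(T - \<theta>) * (T + \<theta>) * (T - \<i> * \<theta>) * (T + \<i> * \<theta>) = T ^ 4 - \<theta> ^ 4"
    by (simp add: algebra_simps power4_eq_xxxx)
  then show ?thesis using assms theta by (auto simp: roots_def add_eq_0_iff2)
qed

lemma roots_power: "T \<in> roots \<Longrightarrow> T ^ 4 = of_nat m"
  using theta by (auto simp: roots_def power_mult_distrib)

text \<open>An embedding is determined by its values at \<i> and \<theta>, which must be roots of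
  \<open>X^2 + 1\<close> and \<open>X^4 - m\<close>.\<close>

lemma embeddings_K: "embeddings K = (\<lambda>(I, T). emb I T) ` ({\<i>, - \<i>} \<times> roots)"
proof (intro equalityI subsetI)
  fix \<sigma> assume \<sigma>: "\<sigma> \<in> embeddings K"
  have K: "\<i> \<in> K" "\<theta> \<in> K"
    using gauss_rats_subset_K gev_in_K[of 0 1 0 0] by (auto simp: gev_def)
  have "\<sigma> \<i> ^ 2 = \<sigma> (of_int (- 1))"
    using embeddings_power[OF K_subfield \<sigma> K(1), of 2] by simp
  then have "(\<sigma> \<i>)\<^sup>2 = \<i>\<^sup>2" by (simp add: embeddings_of_int[OF K_subfield \<sigma>, of "- 1", simplified])
  then have I: "\<sigma> \<i> \<in> {\<i>, - \<i>}" unfolding power2_eq_iff by simp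
  have "\<sigma> \<theta> ^ 4 = \<sigma> (of_nat m)"
    using embeddings_power[OF K_subfield \<sigma> K(2), of 4] theta by simp
  then have T: "\<sigma> \<theta> \<in> roots" by (intro rootsI) (simp add: embeddings_of_nat[OF K_subfield \<sigma>])
  have "\<sigma> = emb (\<sigma> \<i>) (\<sigma> \<theta>)"
  proof (rule extensionalityI)
    show "\<sigma> \<in> extensional K" using embeddingsD(4)[OF \<sigma>] .
    show "emb (\<sigma> \<i>) (\<sigma> \<theta>) \<in> extensional K" by (simp add: emb_def)
    show "\<sigma> x = emb (\<sigma> \<i>) (\<sigma> \<theta>) x" if "x \<in> K" for x
      using that by (elim K_E) (simp add: embedding_gev[OF \<sigma>] emb_gev)
  qed
  then show "\<sigma> \<in> (\<lambda>(I, T). emb I T) ` ({\<i>, - \<i>} \<times> roots)"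
    using I T by (intro image_eqI[of _ _ "(\<sigma> \<i>, \<sigma> \<theta>)"]) auto
next
  fix \<sigma> assume "\<sigma> \<in> (\<lambda>(I, T). emb I T) ` ({\<i>, - \<i>} \<times> roots)"
  then show "\<sigma> \<in> embeddings K" by (auto intro!: emb_embedding roots_power)
qed

text \<open>The first, second and third powers of the four roots each sum to zero; only four copies
  of \<open>a\<close> and of its conjugate survive.\<close>

lemma field_trace_gev:
  assumes "a \<in> gauss_rats" "b \<in> gauss_rats" "c \<in> gauss_rats" "d \<in> gauss_rats"
  shows "field_trace K (gev \<theta> a b c d) = of_real (8 * Re a)"
proof -
  \<comment> \<open>The pair \<open>(I, T)\<close> is recovered by evaluating at \<i> and \<theta>,
    so no two of the eight embeddings coincide.\<close>
  have inj: "inj_on (\<lambda>(I, T). emb I T) ({\<i>, - \<i>} \<times> roots)"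
  proof (rule inj_on_inverseI)
    fix p assume "p \<in> {\<i>, - \<i>} \<times> roots"
    then show "(\<lambda>\<sigma>. (\<sigma> \<i>, \<sigma> \<theta>)) ((\<lambda>(I, T). emb I T) p) = p"
      by (auto simp: emb_simps)
  qed
  have "field_trace K (gev \<theta> a b c d) =
      (\<Sum>(I, T)\<in>{\<i>, - \<i>} \<times> roots. gev T (gconj I a) (gconj I b) (gconj I c) (gconj I d))"
    unfolding field_trace_def embeddings_K sum.reindex[OF inj]
    by (intro sum.cong) (auto simp: emb_gev assms)
  also have "\<dots> = (\<Sum>I\<in>{\<i>, - \<i>}. \<Sum>T\<in>roots. gev T (gconj I a) (gconj I b) (gconj I c) (gconj I d))"
    by (simp add: sum.cartesian_product)
  also have "\<dots> = (\<Sum>I\<in>{\<i>, - \<i>}. 4 * gconj I a)"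
  proof (intro sum.cong refl)
    fix I
    have "\<theta> \<noteq> \<i> * \<theta>" "\<theta> \<noteq> - \<theta>" "\<theta> \<noteq> - \<i> * \<theta>" "\<i> * \<theta> \<noteq> - \<theta>" "\<i> * \<theta> \<noteq> - \<i> * \<theta>" "- \<theta> \<noteq> - \<i> * \<theta>"
      using theta_neq_0 by (auto simp: complex_eq_iff)
    then show "(\<Sum>T\<in>roots. gev T (gconj I a) (gconj I b) (gconj I c) (gconj I d)) = 4 * gconj I a"
      by (simp add: roots_def gev_def power2_eq_square power3_eq_cube algebra_simps)
  qed
  also have "\<dots> = of_real (8 * Re a)"
    by (simp add: complex_eq_iff)
  finally show ?thesis .
qed

lemma algebraic_int_conjugate:
  assumes "algebraic_int (gev \<theta> a b c d)" "I\<^sup>2 = - 1" "T ^ 4 = of_nat m"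
    and G: "a \<in> gauss_rats" "b \<in> gauss_rats" "c \<in> gauss_rats" "d \<in> gauss_rats"
  shows "algebraic_int (gev T (gconj I a) (gconj I b) (gconj I c) (gconj I d))"
  using embeddings_algebraic_int[OF K_subfield emb_embedding[OF assms(2,3)] gev_in_K[OF G] assms(1)]
  by (simp add: emb_gev G)

end

section \<open>Bounding denominators\<close>

lemma half_int_iff_even: "real_of_int x / 2 \<in> \<int> \<longleftrightarrow> even x"
proof
  assume "real_of_int x / 2 \<in> \<int>"
  then obtain n where "real_of_int x / 2 = of_int n" by (elim Ints_cases)
  then have "real_of_int x = of_int (2 * n)" by simp
  then have "x = 2 * n" by linarith
  then show "even x" by simp
qed (auto elim!: evenE)

text \<open>\<open>\<int>[\<i>] / (1 + \<i>)\<close> is the field with two elements.\<close>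

lemma gauss_int_mod_1_plus_i:
  assumes "z \<in> gauss_ints"
  obtains e :: int and w where "e \<in> {0, 1}" "w \<in> gauss_ints" "z = of_int e + (1 + \<i>) * w"
proof -
  obtain p q where z: "z = of_int p + \<i> * of_int q" using assms by (rule gauss_intsE)
  \<comment> \<open>Modulo \<open>1 + \<i>\<close> the unit \<i> is 1, so the residue of
    \<open>z\<close> is the parity of \<open>p + q\<close>.\<close>
  define e where "e = (p + q) mod 2"
  have e: "e \<in> {0, 1}" by (auto simp: e_def)
  obtain r where r: "p + q - e = 2 * r" unfolding e_def by (metis dvd_minus_mod dvdE)
  define w where "w = of_int r + \<i> * of_int (q - r)"
  have "p = 2 * r - q + e" using r by simp
  then have "z = of_int e + (1 + \<i>) * w"
    by (simp add: z w_def complex_eq_iff)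
  with e show ?thesis using that[of e w] by (simp add: w_def)
qed

text \<open>Four generators over the Gaussian integers replace eight over the integers: a class
  modulo \<open>1 + \<i>\<close> is then a vector of four bits.\<close>

definition gauss_lattice :: "complex \<Rightarrow> complex \<Rightarrow> complex \<Rightarrow> complex \<Rightarrow> complex set" where
  "gauss_lattice e\<^sub>1 e\<^sub>2 e\<^sub>3 e\<^sub>4 = {a * e\<^sub>1 + b * e\<^sub>2 + c * e\<^sub>3 + d * e\<^sub>4 | a b c d.
     a \<in> gauss_ints \<and> b \<in> gauss_ints \<and> c \<in> gauss_ints \<and> d \<in> gauss_ints}"

lemma gauss_latticeE:
  assumes "x \<in> gauss_lattice e\<^sub>1 e\<^sub>2 e\<^sub>3 e\<^sub>4"
  obtains a b c d where "a \<in> gauss_ints" "b \<in> gauss_ints" "c \<in> gauss_ints" "d \<in> gauss_ints"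
    "x = a * e\<^sub>1 + b * e\<^sub>2 + c * e\<^sub>3 + d * e\<^sub>4"
  using assms unfolding gauss_lattice_def by blast

text \<open>A lattice over \<open>\<int>[\<i>]\<close> in which no element outside \<open>(1 + \<i>) L\<close> becomes integral after
  division by \<open>1 + \<i>\<close> is saturated at the prime \<open>1 + \<i>\<close>; note that \<open>8 = \<i> (1 + \<i>)\<^sup>6\<close>.\<close>

lemma gauss_lattice_saturated:
  assumes e: "algebraic_int e\<^sub>1" "algebraic_int e\<^sub>2" "algebraic_int e\<^sub>3" "algebraic_int e\<^sub>4"
    and bits: "\<And>a b c d :: int. a \<in> {0, 1} \<Longrightarrow> b \<in> {0, 1} \<Longrightarrow> c \<in> {0, 1} \<Longrightarrow> d \<in> {0, 1} \<Longrightarrow>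
      algebraic_int ((of_int a * e\<^sub>1 + of_int b * e\<^sub>2 + of_int c * e\<^sub>3 + of_int d * e\<^sub>4) / (1 + \<i>)) \<Longrightarrow>
      a = 0 \<and> b = 0 \<and> c = 0 \<and> d = 0"
    and x: "algebraic_int x" "8 * x \<in> gauss_lattice e\<^sub>1 e\<^sub>2 e\<^sub>3 e\<^sub>4"
  shows "x \<in> gauss_lattice e\<^sub>1 e\<^sub>2 e\<^sub>3 e\<^sub>4"
proof -
  let ?L = "gauss_lattice e\<^sub>1 e\<^sub>2 e\<^sub>3 e\<^sub>4"
  have nz: "1 + \<i> \<noteq> 0" by (simp add: complex_eq_iff)
  have step: "y \<in> ?L" if y: "algebraic_int y" "(1 + \<i>) * y \<in> ?L" for y
  proof -
    obtain a b c d where G: "a \<in> gauss_ints" "b \<in> gauss_ints" "c \<in> gauss_ints" "d \<in> gauss_ints"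
      and yeq: "(1 + \<i>) * y = a * e\<^sub>1 + b * e\<^sub>2 + c * e\<^sub>3 + d * e\<^sub>4"
      using y(2) by (rule gauss_latticeE)
    obtain a' :: int and a'' where a: "a' \<in> {0, 1}" "a'' \<in> gauss_ints" "a = of_int a' + (1 + \<i>) * a''"
      using G(1) by (rule gauss_int_mod_1_plus_i)
    obtain b' :: int and b'' where b: "b' \<in> {0, 1}" "b'' \<in> gauss_ints" "b = of_int b' + (1 + \<i>) * b''"
      using G(2) by (rule gauss_int_mod_1_plus_i)
    obtain c' :: int and c'' where c: "c' \<in> {0, 1}" "c'' \<in> gauss_ints" "c = of_int c' + (1 + \<i>) * c''"
      using G(3) by (rule gauss_int_mod_1_plus_i)
    obtain d' :: int and d'' where d: "d' \<in> {0, 1}" "d'' \<in> gauss_ints" "d = of_int d' + (1 + \<i>) * d''"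
      using G(4) by (rule gauss_int_mod_1_plus_i)
    define l where "l = a'' * e\<^sub>1 + b'' * e\<^sub>2 + c'' * e\<^sub>3 + d'' * e\<^sub>4"
    define r where "r = of_int a' * e\<^sub>1 + of_int b' * e\<^sub>2 + of_int c' * e\<^sub>3 + of_int d' * e\<^sub>4"
    have "(1 + \<i>) * y = r + (1 + \<i>) * l"
      unfolding yeq a(3) b(3) c(3) d(3) l_def r_def by (simp add: algebra_simps)
    \<comment> \<open>Both \<open>y\<close> and \<open>l\<close> are integral, hence so is
      \<open>r / (1 + \<i>)\<close>, and \<open>bits\<close> forces \<open>r = 0\<close>.\<close>
    then have yl: "y = r / (1 + \<i>) + l" using nz by (simp add: field_simps)
    have "algebraic_int l"
      unfolding l_def
      by (intro algebraic_int_add algebraic_int_mult e gauss_ints_algebraic_int[OF a(2)]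
          gauss_ints_algebraic_int[OF b(2)] gauss_ints_algebraic_int[OF c(2)] gauss_ints_algebraic_int[OF d(2)])
    then have "algebraic_int (r / (1 + \<i>))"
      using algebraic_int_diff[OF y(1), of l] yl by simp
    then have "a' = 0 \<and> b' = 0 \<and> c' = 0 \<and> d' = 0"
      using bits[OF a(1) b(1) c(1) d(1)] unfolding r_def by blast
    then have "y = l" using yl by (simp add: r_def)
    then show ?thesis
      using a(2) b(2) c(2) d(2) unfolding l_def gauss_lattice_def by blast
  qed
  have "y \<in> ?L" if "algebraic_int y" "(1 + \<i>) ^ n * y \<in> ?L" for n y
    using that
  proof (induction n arbitrary: y)
    case (Suc n)
    have "algebraic_int ((1 + \<i>) * y)"
      using Suc.prems(1) by (intro algebraic_int_mult) (auto intro: algebraic_int_add)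
    then show ?case using Suc step by (simp add: mult_ac)
  qed simp
  moreover have "(1 + \<i>) ^ 6 * x \<in> ?L"
  proof -
    obtain a b c d where G: "a \<in> gauss_ints" "b \<in> gauss_ints" "c \<in> gauss_ints" "d \<in> gauss_ints"
      and eq: "8 * x = a * e\<^sub>1 + b * e\<^sub>2 + c * e\<^sub>3 + d * e\<^sub>4"
      using x(2) by (rule gauss_latticeE)
    have "(1 + \<i>) ^ 6 = ((1 + \<i>)\<^sup>2) ^ 3" by (simp flip: power_mult)
    also have "(1 + \<i>)\<^sup>2 = 2 * \<i>" by (simp add: complex_eq_iff power2_eq_square)
    also have "(2 * \<i>) ^ 3 = - \<i> * 8" by (simp add: power3_eq_cube)
    finally have "(1 + \<i>) ^ 6 = - \<i> * 8" .
    then have "(1 + \<i>) ^ 6 * x = (- \<i> * a) * e\<^sub>1 + (- \<i> * b) * e\<^sub>2 + (- \<i> * c) * e\<^sub>3 + (- \<i> * d) * e\<^sub>4"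
      using eq by (simp add: algebra_simps)
    moreover have "- \<i> * a \<in> gauss_ints" "- \<i> * b \<in> gauss_ints" "- \<i> * c \<in> gauss_ints" "- \<i> * d \<in> gauss_ints"
      using G by (auto intro!: gauss_ints_closed)
    ultimately show ?thesis unfolding gauss_lattice_def by blast
  qed
  ultimately show ?thesis using x(1) by blast
qed

lemma integral_basisI:
  assumes K: "subfield K complex_field" and bs: "\<And>b. b \<in> set bs \<Longrightarrow> b \<in> K \<and> algebraic_int b"
    and indep: "\<And>n j. (\<Sum>j<length bs. of_int (n j) * bs ! j) = 0 \<Longrightarrow> j < length bs \<Longrightarrow> n j = 0"
    and gen: "\<And>x. x \<in> K \<Longrightarrow> algebraic_int x \<Longrightarrow> \<exists>n. x = (\<Sum>j<length bs. of_int (n j) * bs ! j)"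
  shows "integral_basis K bs"
proof -
  have "x \<in> ring_of_integers K" if "x \<in> int_module.span (set bs)" for x
  proof -
    obtain n where x: "x = (\<Sum>j<length bs. of_int (n j) * bs ! j)"
      using \<open>x \<in> int_module.span (set bs)\<close> unfolding span_set_list by blast
    have "algebraic_int x"
      unfolding x using bs by (intro algebraic_int_sum algebraic_int_mult) auto
    moreover have "x \<in> K"
      unfolding x using bs K
      by (intro subfield_complex_sum subfield_complex_fieldD(4)[OF K] subfield_complex_of_int) auto
    ultimately show ?thesis by (simp add: ring_of_integers_def)
  qed
  moreover have "x \<in> int_module.span (set bs)" if "x \<in> ring_of_integers K" for x
    using that gen unfolding ring_of_integers_def span_set_list by blast
  moreover have "distinct bs \<and> int_module.independent (set bs)"
    unfolding distinct_independent_iff using indep by blast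
  ultimately show ?thesis unfolding integral_basis_def by blast
qed

context quartic_field
begin

lemma algebraic_int_theta: "algebraic_int \<theta>"
  by (rule algebraic_int_of_power[of _ 4]) (simp_all add: theta)

text \<open>Discrete Fourier inversion over the four roots, with \<i> held fixed: weighting the
  conjugates by powers of \<i> isolates each term up to the factor 4.\<close>

lemma algebraic_int_components:
  assumes int: "algebraic_int (gev \<theta> a b c d)"
    and G: "a \<in> gauss_rats" "b \<in> gauss_rats" "c \<in> gauss_rats" "d \<in> gauss_rats"
  shows "algebraic_int (4 * a)" "algebraic_int (4 * b * \<theta>)"
    "algebraic_int (4 * c * \<theta>\<^sup>2)" "algebraic_int (4 * d * \<theta> ^ 3)"
proof -
  have conj: "algebraic_int (gev T a b c d)" if "T \<in> roots" for T
    using algebraic_int_conjugate[OF int _ roots_power[OF that] G, of \<i>] by simp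
  note P = conj[of \<theta>] conj[of "\<i> * \<theta>"] conj[of "- \<theta>"] conj[of "- \<i> * \<theta>"]
  have I: "\<i> ^ 3 = - \<i>" "(- \<i>) ^ 3 = \<i>" by (simp_all add: power3_eq_cube)
  have 1: "4 * a = gev \<theta> a b c d + gev (\<i> * \<theta>) a b c d + gev (- \<theta>) a b c d + gev (- \<i> * \<theta>) a b c d"
    by (simp add: gev_def power_mult_distrib I)
  have 2: "4 * b * \<theta> = gev \<theta> a b c d - \<i> * gev (\<i> * \<theta>) a b c d - gev (- \<theta>) a b c d + \<i> * gev (- \<i> * \<theta>) a b c d"
    by (simp add: gev_def power_mult_distrib I algebra_simps)
  have 3: "4 * c * \<theta>\<^sup>2 = gev \<theta> a b c d - gev (\<i> * \<theta>) a b c d + gev (- \<theta>) a b c d - gev (- \<i> * \<theta>) a b c d"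
    by (simp add: gev_def power_mult_distrib I algebra_simps)
  have 4: "4 * d * \<theta> ^ 3 = gev \<theta> a b c d + \<i> * gev (\<i> * \<theta>) a b c d - gev (- \<theta>) a b c d - \<i> * gev (- \<i> * \<theta>) a b c d"
    by (simp add: gev_def power_mult_distrib I algebra_simps)
  have P': "algebraic_int (gev \<theta> a b c d)" "algebraic_int (gev (\<i> * \<theta>) a b c d)"
    "algebraic_int (gev (- \<theta>) a b c d)" "algebraic_int (gev (- \<i> * \<theta>) a b c d)"
    using P by (simp_all add: roots_def)
  show "algebraic_int (4 * a)" "algebraic_int (4 * b * \<theta>)"
    "algebraic_int (4 * c * \<theta>\<^sup>2)" "algebraic_int (4 * d * \<theta> ^ 3)"
    unfolding 1 2 3 4 by (intro algebraic_int_add algebraic_int_diff algebraic_int_mult algebraic_int_ii P')+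
qed

text \<open>Adding and subtracting the two conjugates isolates \<open>8 * Re e\<close> and
  \<open>8 * Im e\<close> times \<open>\<theta> ^ k\<close>. For rational \<open>r\<close>, the
  fourth power of \<open>r * \<theta> ^ k\<close> is the rational \<open>r ^ 4 * m ^ k\<close>, so
  integrality forces \<open>r\<close> into the integers.\<close>

lemma coefficient_times_8:
  assumes "squarefree m" "k \<le> 3" "e \<in> gauss_rats"
    and int: "algebraic_int (4 * e * \<theta> ^ k)" "algebraic_int (4 * cnj e * \<theta> ^ k)"
  shows "8 * e \<in> gauss_ints"
proof -
  have key: "r \<in> \<int>" if r: "r \<in> \<rat>" "algebraic_int (of_real r * \<theta> ^ k)" for r :: real
  proof -
    obtain q where q: "r = of_rat q" using r(1) by (elim Rats_cases)
    have "algebraic_int ((of_real r * \<theta> ^ k) ^ 4)" using r(2) by (rule algebraic_int_power)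
    also have "(of_real r * \<theta> ^ k) ^ 4 = (of_rat (q ^ 4 * of_nat m ^ k) :: complex)"
    proof -
      have "(\<theta> ^ k) ^ 4 = of_nat m ^ k" by (metis mult.commute power_mult theta)
      then show ?thesis
        by (simp add: q power_mult_distrib of_rat_mult of_rat_power complex_of_rat_eq)
    qed
    finally have "(of_rat (q ^ 4 * of_nat m ^ k) :: complex) \<in> \<int>"
      by (rule rational_algebraic_int_is_int) simp
    then obtain n where "(of_rat (q ^ 4 * of_nat m ^ k) :: complex) = of_int n" by (elim Ints_cases)
    then have "(of_rat (q ^ 4 * of_nat m ^ k) :: complex) = of_rat (of_int n)" by simp
    then have "q ^ 4 * of_nat m ^ k = of_int n" by (simp only: of_rat_eq_iff)
    then have "q \<in> \<int>" using rat_int_if_power_mult_int[OF assms(1,2), of q] by simp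
    then show ?thesis by (auto simp: q elim!: Ints_cases)
  qed
  have "of_real (8 * Re e) * \<theta> ^ k = 4 * e * \<theta> ^ k + 4 * cnj e * \<theta> ^ k"
    by (simp add: complex_add_cnj flip: distrib_left distrib_right)
  then have 1: "8 * Re e \<in> \<int>"
    using assms(3) algebraic_int_add[OF int] by (intro key) (auto simp: gauss_rats_def)
  have "- \<i> * (e - cnj e) = of_real (2 * Im e)"
    by (simp add: complex_eq_iff)
  then have "of_real (8 * Im e) = 4 * (- \<i> * (e - cnj e))" by simp
  then have "of_real (8 * Im e) * \<theta> ^ k = 4 * (- \<i> * (e - cnj e)) * \<theta> ^ k" by (rule arg_cong)
  also have "\<dots> = - \<i> * (4 * e * \<theta> ^ k - 4 * cnj e * \<theta> ^ k)"
    by (simp add: algebra_simps)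
  finally have "of_real (8 * Im e) * \<theta> ^ k = - \<i> * (4 * e * \<theta> ^ k - 4 * cnj e * \<theta> ^ k)" .
  then have 2: "8 * Im e \<in> \<int>"
    using assms(3) algebraic_int_mult[OF _ algebraic_int_diff[OF int], of "- \<i>"]
    by (intro key) (auto simp: gauss_rats_def)
  show ?thesis using 1 2 by (simp add: gauss_ints_def)
qed

lemma coefficients_times_8:
  assumes "squarefree m" and int: "algebraic_int (gev \<theta> a b c d)"
    and G: "a \<in> gauss_rats" "b \<in> gauss_rats" "c \<in> gauss_rats" "d \<in> gauss_rats"
  shows "8 * a \<in> gauss_ints" "8 * b \<in> gauss_ints" "8 * c \<in> gauss_ints" "8 * d \<in> gauss_ints"
proof -
  \<comment> \<open>This is the embedding that sends \<i> to \<open>- \<i>\<close> and fixes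
    \<theta>, not conjugation of complex numbers: \<theta> need not be real here.\<close>
  have int': "algebraic_int (gev \<theta> (cnj a) (cnj b) (cnj c) (cnj d))"
    using algebraic_int_conjugate[OF int _ theta G, of "- \<i>"] by simp
  have G': "cnj a \<in> gauss_rats" "cnj b \<in> gauss_rats" "cnj c \<in> gauss_rats" "cnj d \<in> gauss_rats"
    using G by (simp_all add: gauss_rats_def)
  note c = algebraic_int_components[OF int G] algebraic_int_components[OF int' G']
  show "8 * a \<in> gauss_ints" "8 * b \<in> gauss_ints" "8 * c \<in> gauss_ints" "8 * d \<in> gauss_ints"
    using coefficient_times_8[OF assms(1), of 0 a] coefficient_times_8[OF assms(1), of 1 b]
      coefficient_times_8[OF assms(1), of 2 c] coefficient_times_8[OF assms(1), of 3 d] c G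
    by simp_all
qed

text \<open>By \<open>powers\<close> the lattice contains all cubics in \<theta> with Gaussian
  integer coefficients, in particular \<open>8 * x\<close>; saturation removes the factor 8.\<close>

lemma integers_subset_gauss_lattice:
  assumes sf: "squarefree m" and x: "x \<in> K" "algebraic_int x"
    and e: "algebraic_int e\<^sub>1" "algebraic_int e\<^sub>2" "algebraic_int e\<^sub>3" "algebraic_int e\<^sub>4"
    and bits: "\<And>a b c d :: int. a \<in> {0, 1} \<Longrightarrow> b \<in> {0, 1} \<Longrightarrow> c \<in> {0, 1} \<Longrightarrow> d \<in> {0, 1} \<Longrightarrow>
      algebraic_int ((of_int a * e\<^sub>1 + of_int b * e\<^sub>2 + of_int c * e\<^sub>3 + of_int d * e\<^sub>4) / (1 + \<i>)) \<Longrightarrow>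
      a = 0 \<and> b = 0 \<and> c = 0 \<and> d = 0"
    and powers: "\<And>a b c d. a \<in> gauss_ints \<Longrightarrow> b \<in> gauss_ints \<Longrightarrow> c \<in> gauss_ints \<Longrightarrow> d \<in> gauss_ints \<Longrightarrow>
      gev \<theta> a b c d \<in> gauss_lattice e\<^sub>1 e\<^sub>2 e\<^sub>3 e\<^sub>4"
  shows "x \<in> gauss_lattice e\<^sub>1 e\<^sub>2 e\<^sub>3 e\<^sub>4"
proof -
  obtain a b c d where xeq: "x = gev \<theta> a b c d"
    and G: "a \<in> gauss_rats" "b \<in> gauss_rats" "c \<in> gauss_rats" "d \<in> gauss_rats"
    using x(1) by (rule K_E)
  have "gev \<theta> (8 * a) (8 * b) (8 * c) (8 * d) \<in> gauss_lattice e\<^sub>1 e\<^sub>2 e\<^sub>3 e\<^sub>4"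
    using coefficients_times_8[OF sf _ G] x(2) unfolding xeq by (intro powers)
  also have "gev \<theta> (8 * a) (8 * b) (8 * c) (8 * d) = 8 * x"
    by (simp add: xeq gev_def algebra_simps)
  finally show ?thesis using gauss_lattice_saturated[OF e bits x(2)] by blast
qed

end

section \<open>Saturation at \<open>1 + \<i>\<close> in the two residue classes\<close>

lemma gauss_rats_of_int_pair [intro]:
  "of_int p / 2 + \<i> * (of_int q / 2) \<in> gauss_rats"
  by (auto intro!: gauss_rats_closed)

text \<open>The end point of the squaring arguments: once \<theta> is eliminated, integrality
  becomes parity.\<close>

lemma algebraic_int_half_gauss:
  assumes "algebraic_int (of_int p / 2 + \<i> * (of_int q / 2) :: complex)"
  shows "even p \<and> even q"
proof -
  have "of_int p / 2 + \<i> * (of_int q / 2) \<in> gauss_ints"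
    using assms by (intro algebraic_int_gauss_rats) auto
  then show ?thesis by (simp add: gauss_ints_def half_int_iff_even)
qed

context quartic_field
begin

lemma theta_2_2: "\<theta>\<^sup>2 * \<theta>\<^sup>2 = of_nat m"
  using theta by (simp flip: power_add)

lemma of_nat_m_2_mod_4:
  assumes "int m = 4 * j + 2"
  shows "of_nat m = (2 * of_int (2 * j + 1) :: complex)"
proof -
  have "of_nat m = (of_int (int m) :: complex)" by simp
  then show ?thesis unfolding assms by simp
qed

text \<open>These identities give the integrality of the three generators and drive the repeated
  squaring in the saturation proof.\<close>

lemma squares_2_mod_4:
  assumes m: "int m = 4 * j + 2"
  shows "((1 + \<i>) * \<theta>\<^sup>2 / 2)\<^sup>2 = \<i> * of_int (2 * j + 1)"
    and "((1 + \<i>) * \<theta> ^ 3 / 2)\<^sup>2 = \<i> * of_int (2 * j + 1) * \<theta>\<^sup>2"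
    and "(((1 + \<i>) * \<theta> + \<theta> ^ 3) / 2)\<^sup>2 =
      (1 + \<i>) * \<theta>\<^sup>2 / 2 + of_int j * \<theta>\<^sup>2 + (1 + \<i>) * of_int (2 * j + 1)"
proof -
  define k where "k = (of_int (2 * j + 1) :: complex)"
  have k: "k = 2 * of_int j + 1" by (simp add: k_def)
  have i2: "(1 + \<i>)\<^sup>2 = 2 * \<i>" by (simp add: complex_eq_iff power2_eq_square)
  have t4: "\<theta>\<^sup>2 * \<theta>\<^sup>2 = 2 * k" using theta_2_2 of_nat_m_2_mod_4[OF m] by (simp add: k_def)
  have t6: "\<theta> ^ 3 * \<theta> ^ 3 = 2 * k * \<theta>\<^sup>2"
    unfolding t4[symmetric] by (simp flip: power_add)
  have t31: "\<theta> * \<theta> ^ 3 = 2 * k" unfolding t4[symmetric] by (simp flip: power_add power_Suc)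
  have "((1 + \<i>) * \<theta>\<^sup>2 / 2)\<^sup>2 = (1 + \<i>)\<^sup>2 * (\<theta>\<^sup>2 * \<theta>\<^sup>2) / 4" by (simp add: power2_eq_square)
  then show "((1 + \<i>) * \<theta>\<^sup>2 / 2)\<^sup>2 = \<i> * of_int (2 * j + 1)"
    unfolding i2 t4 k_def[symmetric] by simp
  have "((1 + \<i>) * \<theta> ^ 3 / 2)\<^sup>2 = (1 + \<i>)\<^sup>2 * (\<theta> ^ 3 * \<theta> ^ 3) / 4" by (simp add: power2_eq_square)
  then show "((1 + \<i>) * \<theta> ^ 3 / 2)\<^sup>2 = \<i> * of_int (2 * j + 1) * \<theta>\<^sup>2"
    unfolding i2 t6 k_def[symmetric] by simp
  have "(((1 + \<i>) * \<theta> + \<theta> ^ 3) / 2)\<^sup>2 =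
      ((1 + \<i>)\<^sup>2 * \<theta>\<^sup>2 + 2 * (1 + \<i>) * (\<theta> * \<theta> ^ 3) + \<theta> ^ 3 * \<theta> ^ 3) / 4"
    by (simp add: power2_eq_square algebra_simps)
  \<comment> \<open>As \<open>k\<close> is odd, \<open>k * \<theta>^2 / 2\<close> leaves
    \<open>\<theta>^2 / 2\<close>, which joins \<open>\<i> * \<theta>^2 / 2\<close>; this dictates
    the numerator of the generator.\<close>
  also have "\<dots> = (1 + \<i>) * \<theta>\<^sup>2 / 2 + of_int j * \<theta>\<^sup>2 + (1 + \<i>) * k"
    unfolding i2 t31 t6 k by (simp add: field_simps)
  finally show "(((1 + \<i>) * \<theta> + \<theta> ^ 3) / 2)\<^sup>2 =
      (1 + \<i>) * \<theta>\<^sup>2 / 2 + of_int j * \<theta>\<^sup>2 + (1 + \<i>) * of_int (2 * j + 1)"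
    by (simp only: k_def)
qed

text \<open>The element is a root of \<open>X^2 - X + k\<close>: its trace is 1 and its norm
  \<open>(1 + m) / 4\<close>, since \<open>\<i> * \<theta>^2\<close> is a square root of
  \<open>- m\<close>.\<close>

lemma square_3_mod_4:
  assumes "int m = 4 * k - 1"
  shows "((1 + \<i> * \<theta>\<^sup>2) / 2)\<^sup>2 = (1 + \<i> * \<theta>\<^sup>2) / 2 - of_int k"
proof -
  have "of_nat m = (of_int (int m) :: complex)" by simp
  then have M: "of_nat m = (4 * of_int k - 1 :: complex)" unfolding assms by simp
  have "((1 + \<i> * \<theta>\<^sup>2) / 2)\<^sup>2 = (1 + 2 * \<i> * \<theta>\<^sup>2 - \<theta>\<^sup>2 * \<theta>\<^sup>2) / 4"
    by (simp add: power2_eq_square field_simps)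
  also have "\<dots> = (1 + \<i> * \<theta>\<^sup>2) / 2 - of_int k"
    unfolding theta_2_2 M by (simp add: field_simps)
  finally show ?thesis .
qed

text \<open>Squaring is additive modulo the integers that are divisible by two, and
  \<open>(1 + \<i>)\<^sup>2 = 2 \<i>\<close>, so squaring twice leaves an element of \<open>\<rat>(\<i>)\<close>.\<close>

lemma basis_saturated_2_mod_4:
  fixes a b c d j :: int
  assumes m: "int m = 4 * j + 2"
    and bits: "a \<in> {0, 1}" "b \<in> {0, 1}" "c \<in> {0, 1}" "d \<in> {0, 1}"
    and eta: "algebraic_int \<eta>" "\<eta> = ((1 + \<i>) * \<theta> + \<theta> ^ 3) / 2"
    and phi: "algebraic_int \<phi>" "\<phi> = (1 + \<i>) * \<theta>\<^sup>2 / 2"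
    and psi: "algebraic_int \<psi>" "\<psi> = (1 + \<i>) * \<theta> ^ 3 / 2"
    and int: "algebraic_int ((of_int a * 1 + of_int b * \<eta> + of_int c * \<phi> + of_int d * \<psi>) / (1 + \<i>))"
  shows "a = 0 \<and> b = 0 \<and> c = 0 \<and> d = 0"
proof -
  define k where "k = 2 * j + 1"
  define A B C D J k' :: complex where ABC: "A = of_int a" "B = of_int b" "C = of_int c"
    "D = of_int d" "J = of_int j" "k' = of_int k"
  \<comment> \<open>Bits are idempotent, so they stay linear under squaring.\<close>
  have idem: "A\<^sup>2 = A" "B\<^sup>2 = B" "C\<^sup>2 = C" "D\<^sup>2 = D" using bits by (auto simp: ABC)
  have k: "k' = 2 * J + 1" by (simp add: ABC k_def)
  have AI: "algebraic_int A" "algebraic_int B" "algebraic_int C" "algebraic_int D"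
    "algebraic_int J" "algebraic_int k'"
    by (simp_all add: ABC)
  have M: "of_nat m = 2 * k'" using of_nat_m_2_mod_4[OF m] by (simp add: ABC k_def)
  define z where "z = (A + B * \<eta> + C * \<phi> + D * \<psi>) / (1 + \<i>)"
  have z: "algebraic_int z" using int by (simp add: z_def ABC)
  have nz: "1 + \<i> \<noteq> 0" by (simp add: complex_eq_iff)
  have i2: "(1 + \<i>)\<^sup>2 = 2 * \<i>" by (simp add: complex_eq_iff power2_eq_square)
  have zz: "(A + B * \<eta> + C * \<phi> + D * \<psi>)\<^sup>2 = 2 * \<i> * z\<^sup>2"
    using nz by (simp add: z_def power_divide i2)
  have t4: "\<theta>\<^sup>2 * \<theta>\<^sup>2 = 2 * k'" using theta_2_2 M by simp
  have phi2: "\<phi>\<^sup>2 = \<i> * k'" and psi2: "\<psi>\<^sup>2 = \<i> * k' * \<theta>\<^sup>2"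
    and eta2: "\<eta>\<^sup>2 = \<phi> + J * \<theta>\<^sup>2 + (1 + \<i>) * k'"
    using squares_2_mod_4[OF m] by (simp_all only: eta(2) phi(2) psi(2) ABC k_def)
  have t2: "\<theta>\<^sup>2 = (1 - \<i>) * \<phi>" by (simp add: phi(2) algebra_simps)
  \<comment> \<open>Half of the squared numerator is \<open>\<i> * z^2\<close>; the doubled cross
    terms leave integral terms, so half of the sum of squares is integral.\<close>
  define w1 where "w1 = (A + B * \<eta>\<^sup>2 + C * \<phi>\<^sup>2 + D * \<psi>\<^sup>2) / 2"
  have "w1 = \<i> * z\<^sup>2 - (A * B * \<eta> + A * C * \<phi> + A * D * \<psi> + B * C * \<eta> * \<phi> + B * D * \<eta> * \<psi> + C * D * \<phi> * \<psi>)"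
  proof -
    have "(A + B * \<eta> + C * \<phi> + D * \<psi>)\<^sup>2 = A\<^sup>2 + B\<^sup>2 * \<eta>\<^sup>2 + C\<^sup>2 * \<phi>\<^sup>2 + D\<^sup>2 * \<psi>\<^sup>2
      + 2 * (A * B * \<eta> + A * C * \<phi> + A * D * \<psi> + B * C * \<eta> * \<phi> + B * D * \<eta> * \<psi> + C * D * \<phi> * \<psi>)"
      by (simp add: power2_eq_square algebra_simps)
    then show ?thesis unfolding zz idem w1_def by (simp add: field_simps)
  qed
  then have w1: "algebraic_int w1"
    using AI eta(1) phi(1) psi(1) z
    by (simp add: algebraic_int_add algebraic_int_diff algebraic_int_mult algebraic_int_power)
  \<comment> \<open>The factor \<open>1 - \<i>\<close> clears the denominator of every term of
    \<open>w1\<close> divisible by \<open>1 + \<i>\<close>, including multiples of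
    \<open>\<theta>^2 = (1 - \<i>) * \<phi>\<close>; the other terms form \<open>w2\<close>.\<close>
  define w2 where "w2 = (A + C * \<i> * k' + B * \<phi>) * (1 - \<i>) / 2"
  have "w2 = w1 * (1 - \<i>) + \<i> * B * J * \<phi> - B * k' - D * k' * \<phi>"
    unfolding w2_def w1_def phi2 psi2 eta2 t2 by (simp add: field_simps)
  then have w2: "algebraic_int w2"
    using w1 AI phi(1)
    by (simp add: algebraic_int_add algebraic_int_diff algebraic_int_mult)
  \<comment> \<open>Second squaring: \<open>(1 - \<i>)^2 = - 2 * \<i>\<close>, and
    \<open>\<phi>^2 = \<i> * k'\<close> removes the last power of \<theta>.\<close>
  define w3 where "w3 = (A - C * k'\<^sup>2 + B * \<i> * k') / 2"
  have "w3 = \<i> * w2\<^sup>2 - A * C * \<i> * k' - (A + C * \<i> * k') * B * \<phi>"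
  proof -
    have i: "(1 - \<i>)\<^sup>2 = - 2 * \<i>" by (simp add: complex_eq_iff power2_eq_square)
    have "\<i> * w2\<^sup>2 = (A + C * \<i> * k' + B * \<phi>)\<^sup>2 / 2"
      unfolding w2_def by (simp add: power_mult_distrib power_divide i)
    also have "(A + C * \<i> * k' + B * \<phi>)\<^sup>2 = A\<^sup>2 - C\<^sup>2 * k'\<^sup>2 + B\<^sup>2 * \<phi>\<^sup>2 + 2 * (A * C * \<i> * k' + (A + C * \<i> * k') * B * \<phi>)"
      by (simp add: power2_eq_square algebra_simps)
    finally show ?thesis unfolding idem phi2 w3_def by (simp add: field_simps)
  qed
  then have "algebraic_int w3"
    using w2 AI phi(1)
    by (simp add: algebraic_int_add algebraic_int_diff algebraic_int_mult algebraic_int_power)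
  also have "w3 = of_int (a - c * k\<^sup>2) / 2 + \<i> * (of_int (b * k) / 2)"
    by (simp add: w3_def ABC field_simps)
  finally have "even (a - c * k\<^sup>2) \<and> even (b * k)" by (rule algebraic_int_half_gauss)
  then have bc: "b = 0" "c = a" using bits by (auto simp: k_def)
  have w1': "w1 = gev \<theta> ((A + A * \<i> * k') / 2) 0 (D * \<i> * k' / 2) 0"
    by (simp add: w1_def phi2 psi2 gev_def ABC bc field_simps)
  \<comment> \<open>The conjugate \<theta> -> \<open>\<i> * \<theta>\<close> negates
    \<open>\<theta>^2\<close>, so its product with \<open>w1\<close> is a relative norm in the
    Gaussian rationals; it decides the bits \<open>a\<close> and \<open>d\<close>.\<close>
  have "algebraic_int (gev (\<i> * \<theta>) ((A + A * \<i> * k') / 2) 0 (D * \<i> * k' / 2) 0)"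
    using algebraic_int_conjugate[of _ _ _ _ \<i> "\<i> * \<theta>"] w1 unfolding w1'
    by (simp add: power_mult_distrib theta ABC gauss_rats_closed)
  then have "algebraic_int (w1 * gev (\<i> * \<theta>) ((A + A * \<i> * k') / 2) 0 (D * \<i> * k' / 2) 0)"
    by (rule algebraic_int_mult[OF w1])
  also have "w1 * gev (\<i> * \<theta>) ((A + A * \<i> * k') / 2) 0 (D * \<i> * k' / 2) 0 =
      (A\<^sup>2 * (1 + 2 * \<i> * k' - k'\<^sup>2) + D\<^sup>2 * k'\<^sup>2 * (\<theta>\<^sup>2 * \<theta>\<^sup>2)) / 4"
    unfolding w1' by (simp add: gev_def power_mult_distrib power2_eq_square field_simps)
  also have "\<dots> = (A * (1 + 2 * \<i> * k' - k'\<^sup>2) + D * k'\<^sup>2 * (2 * k')) / 4"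
    unfolding idem t4 ..
  also have "k'\<^sup>2 = 4 * (J\<^sup>2 + J) + 1"
    by (simp add: k power2_eq_square algebra_simps)
  also have "(A * (1 + 2 * \<i> * k' - (4 * (J\<^sup>2 + J) + 1)) + D * (4 * (J\<^sup>2 + J) + 1) * (2 * k')) / 4 =
     of_int (d * k) / 2 + \<i> * (of_int (a * k) / 2) - A * (J\<^sup>2 + J) + 2 * D * (J\<^sup>2 + J) * k'"
    by (simp add: ABC field_simps)
  finally have "algebraic_int (of_int (d * k) / 2 + \<i> * (of_int (a * k) / 2) - A * (J\<^sup>2 + J) + 2 * D * (J\<^sup>2 + J) * k')"
    (is "algebraic_int ?w") .
  moreover have "algebraic_int (A * (J\<^sup>2 + J))" "algebraic_int (2 * D * (J\<^sup>2 + J) * k')"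
    using AI by (simp_all add: algebraic_int_add algebraic_int_mult algebraic_int_power)
  ultimately have "algebraic_int (?w + A * (J\<^sup>2 + J) - 2 * D * (J\<^sup>2 + J) * k')"
    by (intro algebraic_int_diff[OF algebraic_int_add])
  then have "algebraic_int (of_int (d * k) / 2 + \<i> * (of_int (a * k) / 2) :: complex)" by simp
  then have "even (d * k) \<and> even (a * k)" by (rule algebraic_int_half_gauss)
  then show ?thesis using bits bc by (auto simp: k_def)
qed

text \<open>With \<open>\<alpha> = (1 + \<i> \<theta>\<^sup>2) / 2\<close>, the ring \<open>\<int>[\<alpha>]\<close> has no nilpotent elements modulo two: the fourth
  power is there the identity.\<close>

lemma quartic_power_even:
  fixes s t k :: int
  assumes m: "int m = 4 * k - 1" and alpha: "algebraic_int \<alpha>" "\<alpha> = (1 + \<i> * \<theta>\<^sup>2) / 2"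
    and int: "algebraic_int ((of_int s + of_int t * \<alpha>) ^ 4 / 2)"
  shows "even s \<and> even t"
proof -
  define S T k' :: complex where ST: "S = of_int s" "T = of_int t" "k' = of_int k"
  have AI: "algebraic_int S" "algebraic_int T" "algebraic_int k'" by (simp_all add: ST)
  have a2: "\<alpha>\<^sup>2 = \<alpha> - k'" using square_3_mod_4[OF m] by (simp add: alpha(2) ST)
  \<comment> \<open>Modulo two \<open>k\<close> is idempotent; hence the fourth power fixes \<alpha>
    modulo two.\<close>
  have "even (k * k - k)" by simp
  then obtain h where h: "k * k - k = 2 * h" by (elim evenE)
  have h': "k' * k' = k' + 2 * of_int h"
  proof -
    have "k * k = k + 2 * h" using h by simp
    then have "(of_int (k * k) :: complex) = of_int (k + 2 * h)" by simp
    then show ?thesis by (simp add: ST)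
  qed
  have a4: "\<alpha> ^ 4 = \<alpha> + 2 * (of_int h - k' * \<alpha>)"
  proof -
    have "\<alpha> ^ 4 = (\<alpha>\<^sup>2)\<^sup>2" by (simp flip: power_mult)
    also have "\<dots> = (\<alpha> - k')\<^sup>2" unfolding a2 ..
    also have "\<dots> = \<alpha>\<^sup>2 - 2 * k' * \<alpha> + k' * k'" by (simp add: power2_eq_square algebra_simps)
    finally show ?thesis unfolding a2 h' by (simp add: algebra_simps)
  qed
  \<comment> \<open>Modulo two the fourth power is additive and fixes \<alpha>, so \<open>w\<close>
    differs from the given element by an integral one.\<close>
  define w where "w = (S ^ 4 + T ^ 4 * \<alpha>) / 2"
  have "(S + T * \<alpha>) ^ 4 = S ^ 4 + T ^ 4 * \<alpha> ^ 4 + 2 * (2 * S ^ 3 * T * \<alpha> + 3 * S\<^sup>2 * T\<^sup>2 * \<alpha>\<^sup>2 + 2 * S * T ^ 3 * \<alpha> ^ 3)"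
    by (simp add: power4_eq_xxxx power3_eq_cube power2_eq_square algebra_simps)
  then have "w = (S + T * \<alpha>) ^ 4 / 2 - (2 * S ^ 3 * T * \<alpha> + 3 * S\<^sup>2 * T\<^sup>2 * \<alpha>\<^sup>2 + 2 * S * T ^ 3 * \<alpha> ^ 3)
      - T ^ 4 * (of_int h - k' * \<alpha>)"
    unfolding a4 w_def by (simp add: field_simps)
  moreover have "algebraic_int ((S + T * \<alpha>) ^ 4 / 2)" using int by (simp add: ST)
  ultimately have w: "algebraic_int w"
    using AI alpha(1)
    by (simp add: algebraic_int_add algebraic_int_diff algebraic_int_mult algebraic_int_power)
  have w': "w = gev \<theta> ((2 * S ^ 4 + T ^ 4) / 4) 0 (\<i> * T ^ 4 / 4) 0"
    by (simp add: w_def gev_def alpha(2) field_simps)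
  \<comment> \<open>The conjugate sends \<alpha> to \<open>1 - \<alpha>\<close>; the trace of
    \<open>w\<close> sees the parity of \<open>t\<close> alone.\<close>
  have "algebraic_int (gev (\<i> * \<theta>) ((2 * S ^ 4 + T ^ 4) / 4) 0 (\<i> * T ^ 4 / 4) 0)"
    using algebraic_int_conjugate[of _ _ _ _ \<i> "\<i> * \<theta>"] w unfolding w'
    by (simp add: power_mult_distrib theta ST)
  then have "algebraic_int (w + gev (\<i> * \<theta>) ((2 * S ^ 4 + T ^ 4) / 4) 0 (\<i> * T ^ 4 / 4) 0)"
    by (rule algebraic_int_add[OF w])
  also have "w + gev (\<i> * \<theta>) ((2 * S ^ 4 + T ^ 4) / 4) 0 (\<i> * T ^ 4 / 4) 0 =
      of_int (2 * s ^ 4 + t ^ 4) / 2 + \<i> * (of_int 0 / 2)"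
  proof -
    have "gev \<theta> p 0 q 0 + gev (\<i> * \<theta>) p 0 q 0 = 2 * p" for p q
      by (simp add: gev_def power_mult_distrib)
    then show ?thesis unfolding w' by (simp add: ST)
  qed
  finally have "even (2 * s ^ 4 + t ^ 4)" using algebraic_int_half_gauss by blast
  then have t: "even t" by simp
  then obtain r where r: "t = 2 * r" by (elim evenE)
  have "of_int (s ^ 4) / 2 + \<i> * (of_int 0 / 2) = w - 8 * of_int r ^ 4 * \<alpha>"
    by (simp add: w_def ST r field_simps)
  moreover have "algebraic_int (w - 8 * of_int r ^ 4 * \<alpha>)"
    using w alpha(1) by (intro algebraic_int_diff algebraic_int_mult algebraic_int_power) auto
  ultimately have "even (s ^ 4)" using algebraic_int_half_gauss by metis
  with t show ?thesis by simp
qed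

text \<open>Write the numerator as \<open>u + v * \<theta>\<close> with \<open>u\<close>,
  \<open>v\<close> integer combinations of 1 and \<alpha>. As \<open>\<theta>^2\<close> is \<i>
  modulo two, squaring makes \<open>u^2 + \<i> * v^2\<close> divisible by two. This yields that
  \<open>(u + v)^4 / 2\<close> is integral, so \<open>u = v\<close>, and then the same for
  \<open>u^4 / 2\<close>.\<close>

lemma basis_saturated_3_mod_4:
  fixes a b c d k :: int
  assumes m: "int m = 4 * k - 1"
    and bits: "a \<in> {0, 1}" "b \<in> {0, 1}" "c \<in> {0, 1}" "d \<in> {0, 1}"
    and alpha: "algebraic_int \<alpha>" "\<alpha> = (1 + \<i> * \<theta>\<^sup>2) / 2"
    and int: "algebraic_int ((of_int a * 1 + of_int b * \<alpha> + of_int c * \<theta> + of_int d * (\<theta> * \<alpha>)) / (1 + \<i>))"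
  shows "a = 0 \<and> b = 0 \<and> c = 0 \<and> d = 0"
proof -
  define u where "u = of_int a + of_int b * \<alpha>"
  define v where "v = of_int c + of_int d * \<alpha>"
  define z where "z = (u + v * \<theta>) / (1 + \<i>)"
  have AI: "algebraic_int u" "algebraic_int v"
    unfolding u_def v_def using alpha(1) by (auto intro!: algebraic_int_add algebraic_int_mult)
  note AI_simps = algebraic_int_add algebraic_int_diff algebraic_int_mult algebraic_int_power
    algebraic_int_theta
  have z: "algebraic_int z"
    using int by (simp add: z_def u_def v_def algebra_simps)
  have nz: "1 + \<i> \<noteq> 0" by (simp add: complex_eq_iff)
  have i2: "(1 + \<i>)\<^sup>2 = 2 * \<i>" by (simp add: complex_eq_iff power2_eq_square)
  have t2: "\<theta>\<^sup>2 = \<i> - 2 * \<i> * \<alpha>" by (simp add: alpha(2) field_simps)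
  have "2 * \<i> * z\<^sup>2 = (u + v * \<theta>)\<^sup>2" using nz by (simp add: z_def power_divide i2)
  also have "\<dots> = u\<^sup>2 + v\<^sup>2 * \<theta>\<^sup>2 + 2 * u * v * \<theta>" by (simp add: power2_eq_square algebra_simps)
  finally have zz: "u\<^sup>2 + \<i> * v\<^sup>2 = 2 * (\<i> * z\<^sup>2 + \<i> * \<alpha> * v\<^sup>2 - u * v * \<theta>)"
    unfolding t2 by (simp add: algebra_simps)
  \<comment> \<open>Squaring turns the factor \<open>(1 + \<i>) / 2\<close> into
    \<open>\<i> / 2\<close>.\<close>
  have fourth: "algebraic_int (x ^ 4 / 2)" if "algebraic_int ((1 + \<i>) * x\<^sup>2 / 2)" for x
  proof -
    have "algebraic_int (- \<i> * ((1 + \<i>) * x\<^sup>2 / 2)\<^sup>2)"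
      using that by (intro algebraic_int_mult algebraic_int_power) auto
    also have "- \<i> * ((1 + \<i>) * x\<^sup>2 / 2)\<^sup>2 = x ^ 4 / 2"
      by (simp add: power_mult_distrib power_divide i2 flip: power_mult)
    finally show ?thesis .
  qed
  \<comment> \<open>Since \<open>(1 + \<i>) * \<i> = (1 + \<i>) - 2\<close>, multiplying by
    \<open>1 + \<i>\<close> lets \<i> be replaced by 1 modulo two.\<close>
  have "(1 + \<i>) * (u + v)\<^sup>2 / 2 = (1 + \<i>) * (u\<^sup>2 + \<i> * v\<^sup>2) / 2 + (1 + \<i>) * u * v + v\<^sup>2"
    by (simp add: power2_eq_square field_simps)
  also have "\<dots> = (1 + \<i>) * (\<i> * z\<^sup>2 + \<i> * \<alpha> * v\<^sup>2 - u * v * \<theta>) + (1 + \<i>) * u * v + v\<^sup>2"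
    unfolding zz by simp
  finally have "algebraic_int ((1 + \<i>) * (u + v)\<^sup>2 / 2)"
    using AI z alpha(1) by (simp add: AI_simps)
  then have "algebraic_int ((u + v) ^ 4 / 2)" by (rule fourth)
  also have "u + v = of_int (a + c) + of_int (b + d) * \<alpha>"
    by (simp add: u_def v_def algebra_simps)
  finally have "even (a + c) \<and> even (b + d)" using quartic_power_even[OF m alpha] by blast
  then have eq: "c = a" "d = b" using bits by auto
  then have "v = u" by (simp add: u_def v_def)
  then have "u\<^sup>2 + \<i> * u\<^sup>2 = 2 * (\<i> * z\<^sup>2 + \<i> * \<alpha> * u\<^sup>2 - u * u * \<theta>)"
    using zz by simp
  moreover have "(1 + \<i>) * u\<^sup>2 / 2 = (u\<^sup>2 + \<i> * u\<^sup>2) / 2"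
    by (simp add: distrib_right)
  ultimately have "(1 + \<i>) * u\<^sup>2 / 2 = \<i> * z\<^sup>2 + \<i> * \<alpha> * u\<^sup>2 - u * u * \<theta>"
    by simp
  then have "algebraic_int ((1 + \<i>) * u\<^sup>2 / 2)"
    using AI z alpha(1) by (simp add: AI_simps)
  then have "algebraic_int (u ^ 4 / 2)" by (rule fourth)
  then have "even a \<and> even b" unfolding u_def by (rule quartic_power_even[OF m alpha])
  then show ?thesis using bits eq by auto
qed

end

section \<open>Integral bases and discriminants\<close>

lemma less_8_cases:
  assumes "i < 8"
  obtains "i = 0" | "i = 1" | "i = 2" | "i = 3" | "i = 4" | "i = 5" | "i = 6" | "i = (7 :: nat)"
  using assms by linarith

lemma sum_lessThan_8: "(\<Sum>j<8. f j) = f 0 + f 1 + f 2 + f 3 + f 4 + f 5 + f 6 + f (7 :: nat)"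
  by (simp add: eval_nat_numeral ac_simps)

lemma sum_basis_8:
  assumes "length bs = 8"
  shows "(\<Sum>j<length bs. of_int (n j) * bs ! j) =
    (of_int (n 0) * bs ! 0 + of_int (n 1) * bs ! 1 + of_int (n 2) * bs ! 2 + of_int (n 3) * bs ! 3 +
     of_int (n 4) * bs ! 4 + of_int (n 5) * bs ! 5 + of_int (n 6) * bs ! 6 + of_int (n 7) * bs ! 7 :: complex)"
  unfolding assms by (rule sum_lessThan_8)

lemma prod_lessThan_8: "(\<Prod>j<8. f j) = f 0 * f 1 * f 2 * f 3 * f 4 * f 5 * f 6 * f (7 :: nat)"
  by (simp add: eval_nat_numeral ac_simps)

context quartic_field
begin

text \<open>In this order both claimed bases have lower triangular coordinate matrices.\<close>

definition monomials :: "complex list" where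
  "monomials = [1, \<theta>, \<theta>\<^sup>2, \<theta> ^ 3, \<i>, \<i> * \<theta>, \<i> * \<theta>\<^sup>2, \<i> * \<theta> ^ 3]"

lemma length_monomials [simp]: "length monomials = 8"
  by (simp add: monomials_def)

lemma monomials_nth: "r < 8 \<Longrightarrow> monomials ! r = \<i> ^ (r div 4) * \<theta> ^ (r mod 4)"
  by (erule less_8_cases) (simp_all add: monomials_def)

lemma monomials_in_K: "set monomials \<subseteq> K"
proof -
  have "\<i> ^ r * \<theta> ^ s \<in> K" for r s
    \<comment> \<open>Only the closure of \<open>K\<close> under powers is taken from
      \<open>embeddings_power\<close>; the identity embedding provides an instance.\<close>
    using embeddings_power[OF K_subfield emb_embedding[OF _ theta, of \<i>]]
      gauss_rats_subset_K gev_in_K[of 0 1 0 0] by (intro K_mult) (auto simp: gev_def)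
  then show ?thesis
    by (auto simp: in_set_conv_nth monomials_nth)
qed

lemma field_trace_monomial:
  assumes "s < 8"
  shows "field_trace K (\<i> ^ r * \<theta> ^ s) =
    (if s mod 4 = 0 then of_real (8 * Re (\<i> ^ r)) * of_nat m ^ (s div 4) else 0)"
proof -
  define c where "c = \<i> ^ r * of_nat m ^ (s div 4)"
  have c: "c \<in> gauss_rats" unfolding c_def by (intro gauss_rats_closed)
  have "\<theta> ^ s = \<theta> ^ (4 * (s div 4) + s mod 4)" by simp
  also have "\<dots> = of_nat m ^ (s div 4) * \<theta> ^ (s mod 4)"
    unfolding power_add power_mult theta ..
  finally have eq: "\<i> ^ r * \<theta> ^ s = c * \<theta> ^ (s mod 4)" by (simp add: c_def)
  have Re: "Re c = Re (\<i> ^ r) * real m ^ (s div 4)"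
  proof -
    have "c = \<i> ^ r * of_real (real m ^ (s div 4))" by (simp add: c_def)
    then show ?thesis by (simp only: Re_complex_of_real Im_complex_of_real times_complex.sel mult_zero_right diff_zero)
  qed
  have "s mod 4 < 4" by simp
  then consider "s mod 4 = 0" | "s mod 4 = 1" | "s mod 4 = 2" | "s mod 4 = 3" by linarith
  then show ?thesis
  proof cases
    case 1
    then show ?thesis
      using field_trace_gev[of c 0 0 0] c unfolding eq by (simp add: gev_def Re)
  next
    case 2
    then show ?thesis
      using field_trace_gev[of 0 c 0 0] c unfolding eq by (simp add: gev_def)
  next
    case 3
    then show ?thesis
      using field_trace_gev[of 0 0 c 0] c unfolding eq by (simp add: gev_def)
  next
    case 4
    then show ?thesis
      using field_trace_gev[of 0 0 0 c] c unfolding eq by (simp add: gev_def)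
  qed
qed

text \<open>After exchanging \<open>\<theta>\<close> with \<open>\<theta>\<^sup>3\<close> and \<open>\<i> \<theta>\<close> with \<open>\<i> \<theta>\<^sup>3\<close> in the rows, the trace matrix is diagonal.\<close>

lemma basis_discriminant_monomials: "basis_discriminant K monomials = 2 ^ 24 * of_nat m ^ 6"
proof -
  define D where "D = Matrix.mat 8 8 (\<lambda>(r, s). field_trace K (monomials ! r * monomials ! s))"
  define E where "E = swaprows 1 3 (swaprows 5 7 D)"
  have D: "D \<in> carrier_mat 8 8" by (simp add: D_def)
  have E: "E \<in> carrier_mat 8 8" using D by (simp add: E_def)
  have entry: "D $$ (r, s) = (if (r mod 4 + s mod 4) mod 4 = 0
      then of_real (8 * Re (\<i> ^ (r div 4 + s div 4))) * of_nat m ^ ((r mod 4 + s mod 4) div 4) else 0)"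
    if "r < 8" "s < 8" for r s
  proof -
    have "r mod 4 < 4" "s mod 4 < 4" by simp_all
    then have lt: "r mod 4 + s mod 4 < 8" by linarith
    have "monomials ! r * monomials ! s = \<i> ^ (r div 4 + s div 4) * \<theta> ^ (r mod 4 + s mod 4)"
      using that by (simp add: monomials_nth power_add)
    then show ?thesis using that by (simp add: D_def field_trace_monomial[OF lt])
  qed
  \<comment> \<open>The sign in the last four rows is \<open>\<i>^2 = - 1\<close>; the factor
    \<open>m\<close> is \<open>\<theta> * \<theta> ^ 3\<close> or
    \<open>\<theta>^2 * \<theta>^2\<close>.\<close>
  have Eentry: "E $$ (r, s) = (if r = s then (if r < 4 then 8 else - 8) * (if r mod 4 = 0 then 1 else of_nat m) else 0)"
    if "r < 8" "s < 8" for r s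
  proof -
    have *: "E $$ (r, s) = D $$ (if r = 1 then 3 else if r = 3 then 1 else if r = 5 then 7 else if r = 7 then 5 else r, s)"
      using that D by (simp add: E_def)
    show ?thesis unfolding *
      using that(1) by (rule less_8_cases; use that(2) in \<open>rule less_8_cases\<close>) (simp_all add: entry)
  qed
  have "Determinant.det E = prod_list (diag_mat E)"
    by (rule det_lower_triangular[OF _ E]) (simp add: Eentry)
  also have "\<dots> = (\<Prod>r<8. E $$ (r, r))"
    using E by (simp add: prod_list_diag_prod atLeast0LessThan)
  also have "\<dots> = (\<Prod>r<8 :: nat. (if r < 4 then 8 else - 8) * (if r mod 4 = 0 then 1 else of_nat m))"
    by (intro prod.cong) (simp_all add: Eentry)
  also have "\<dots> = 2 ^ 24 * (of_nat m * of_nat m * of_nat m * of_nat m * of_nat m * of_nat m)"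
    unfolding prod_lessThan_8 by simp
  also have "of_nat m * of_nat m * of_nat m * of_nat m * of_nat m * of_nat m = (of_nat m ^ 6 :: complex)"
    by (simp add: numeral_eq_Suc)
  finally have "Determinant.det E = 2 ^ 24 * of_nat m ^ 6" .
  \<comment> \<open>The signs of the two row swaps cancel.\<close>
  moreover have "Determinant.det E = Determinant.det D"
    using D by (simp add: E_def det_swaprows[of _ 8])
  ultimately show ?thesis by (simp add: basis_discriminant_def D_def)
qed

lemma basis_discriminant_triangular:
  assumes "length bs = 8"
    and bs: "\<And>i. i < 8 \<Longrightarrow> bs ! i = (\<Sum>j<8. of_rat (P i j) * monomials ! j)"
    and lower: "\<And>i j. i < j \<Longrightarrow> j < 8 \<Longrightarrow> P i j = 0"
  shows "basis_discriminant K bs = (of_rat (\<Prod>i<8. P i i))\<^sup>2 * (2 ^ 24 * of_nat m ^ 6)"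
proof -
  define A where "A = (Matrix.mat 8 8 (\<lambda>(i, j). of_rat (P i j)) :: complex Matrix.mat)"
  have A: "A \<in> carrier_mat 8 8" by (simp add: A_def)
  have "Determinant.det A = prod_list (diag_mat A)"
    by (rule det_lower_triangular[OF _ A]) (simp add: A_def lower)
  also have "\<dots> = of_rat (\<Prod>i<8. P i i)"
    by (simp add: prod_list_diag_prod A_def of_rat_prod atLeast0LessThan)
  finally show ?thesis
    using basis_discriminant_change[OF K_subfield monomials_in_K, of bs P] assms(1) bs
    by (simp add: A_def basis_discriminant_monomials)
qed

lemma K_closed [intro, simp]:
  "z \<in> gauss_rats \<Longrightarrow> z \<in> K" "\<theta> \<in> K" "x \<in> K \<Longrightarrow> x ^ n \<in> K" "x \<in> K \<Longrightarrow> y \<in> K \<Longrightarrow> x * y \<in> K"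
  "x \<in> K \<Longrightarrow> y \<in> K \<Longrightarrow> x + y \<in> K" "x \<in> K \<Longrightarrow> x / numeral l \<in> K"
proof -
  note F = subfield_complex_fieldD[OF K_subfield]
  show g: "z \<in> K" if "z \<in> gauss_rats" for z using that gauss_rats_subset_K by blast
  show "\<theta> \<in> K" using gev_in_K[of 0 1 0 0] by (simp add: gev_def)
  show "x \<in> K \<Longrightarrow> x ^ n \<in> K" by (induction n) (simp_all add: F)
  show "x \<in> K \<Longrightarrow> y \<in> K \<Longrightarrow> x * y \<in> K" "x \<in> K \<Longrightarrow> y \<in> K \<Longrightarrow> x + y \<in> K" by (simp_all add: F)
  show "x / numeral l \<in> K" if "x \<in> K"
    unfolding divide_inverse using that by (intro F(4) F(6)[OF g]) simp_all
qed

section \<open>The two integral bases and their discriminants\<close>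

lemma integral_basis_2_mod_4:
  assumes sf: "squarefree m" and m: "int m = 4 * j + 2"
  shows "integral_basis K [1, \<theta>, \<theta>\<^sup>2, \<theta> ^ 3, \<i>, ((1 + \<i>) * \<theta> + \<theta> ^ 3) / 2, (1 + \<i>) * \<theta>\<^sup>2 / 2, (1 + \<i>) * \<theta> ^ 3 / 2]"
    (is "integral_basis K ?bs")
proof (rule integral_basisI[OF K_subfield])
  define \<eta> \<phi> \<psi> where "\<eta> = ((1 + \<i>) * \<theta> + \<theta> ^ 3) / 2" and "\<phi> = (1 + \<i>) * \<theta>\<^sup>2 / 2" and "\<psi> = (1 + \<i>) * \<theta> ^ 3 / 2"
  note defs = \<eta>_def \<phi>_def \<psi>_def
  note sq = squares_2_mod_4[OF m, folded defs]
  note AI_simps = algebraic_int_add algebraic_int_diff algebraic_int_mult algebraic_int_power algebraic_int_theta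
  \<comment> \<open>The generators are integral because their squares are; \<open>\<eta>\<close>
    comes last, as its square involves \<open>\<phi>\<close>.\<close>
  have "algebraic_int (\<phi>\<^sup>2)" "algebraic_int (\<psi>\<^sup>2)" unfolding sq(1,2) by (simp_all add: AI_simps)
  then have phi: "algebraic_int \<phi>" and psi: "algebraic_int \<psi>"
    using algebraic_int_of_power[of _ 2] by simp_all
  then have "algebraic_int (\<eta>\<^sup>2)" unfolding sq(3) by (simp add: AI_simps)
  then have eta: "algebraic_int \<eta>" using algebraic_int_of_power[of _ 2] by simp
  have "\<forall>b\<in>set ?bs. b \<in> K \<and> algebraic_int b"
    using eta phi psi unfolding defs by (simp add: AI_simps)
  then show "b \<in> K \<and> algebraic_int b" if "b \<in> set ?bs" for b using that by blast
  have expand: "(\<Sum>i<length ?bs. of_int (n i) * ?bs ! i) =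
      gev \<theta> (of_int (n 0) + \<i> * of_int (n 4)) (of_int (n 1) + (1 + \<i>) * of_int (n 5) / 2)
        (of_int (n 2) + (1 + \<i>) * of_int (n 6) / 2)
        (of_int (n 3) + of_int (n 5) / 2 + (1 + \<i>) * of_int (n 7) / 2)" for n
    by (subst sum_basis_8) (simp_all add: gev_def algebra_simps add_divide_distrib)
  show "n i = 0" if eq: "(\<Sum>i<length ?bs. of_int (n i) * ?bs ! i) = 0" and i: "i < length ?bs" for n i
  proof -
    have "of_int (n 0) + \<i> * of_int (n 4) = 0 \<and> of_int (n 1) + (1 + \<i>) * of_int (n 5) / 2 = 0 \<and>
        of_int (n 2) + (1 + \<i>) * of_int (n 6) / 2 = 0 \<and>
        of_int (n 3) + of_int (n 5) / 2 + (1 + \<i>) * of_int (n 7) / 2 = 0"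
      using eq unfolding expand by (intro gev_eq_0[OF theta]) auto
    then have "\<forall>i<8. n i = 0"
      by (auto simp: complex_eq_iff elim!: less_8_cases)
    then show ?thesis using i by simp
  qed
  fix x assume x: "x \<in> K" "algebraic_int x"
  have "x \<in> gauss_lattice 1 \<eta> \<phi> \<psi>"
  proof (rule integers_subset_gauss_lattice[OF sf x algebraic_int_1 eta phi psi])
    fix a b c d :: int
    assume "a \<in> {0, 1}" "b \<in> {0, 1}" "c \<in> {0, 1}" "d \<in> {0, 1}"
      "algebraic_int ((of_int a * 1 + of_int b * \<eta> + of_int c * \<phi> + of_int d * \<psi>) / (1 + \<i>))"
    then show "a = 0 \<and> b = 0 \<and> c = 0 \<and> d = 0"
      by (rule basis_saturated_2_mod_4[OF m _ _ _ _ eta \<eta>_def phi \<phi>_def psi \<psi>_def])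
  next
    fix a b c d assume "a \<in> gauss_ints" "b \<in> gauss_ints" "c \<in> gauss_ints" "d \<in> gauss_ints"
    \<comment> \<open>The coefficients come from
      \<open>\<theta> = (1 - \<i>) * \<eta> + \<i> * \<psi>\<close>,
      \<open>\<theta>^2 = (1 - \<i>) * \<phi>\<close> and
      \<open>\<theta> ^ 3 = (1 - \<i>) * \<psi>\<close>.\<close>
    moreover have "gev \<theta> a b c d = a * 1 + (b * (1 - \<i>)) * \<eta> + (c * (1 - \<i>)) * \<phi> + (b * \<i> + d * (1 - \<i>)) * \<psi>"
      by (simp add: gev_def defs field_simps)
    ultimately show "gev \<theta> a b c d \<in> gauss_lattice 1 \<eta> \<phi> \<psi>"
      unfolding gauss_lattice_def
      by (blast intro: gauss_ints_closed)
  qed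
  then obtain a b c d where G: "a \<in> gauss_ints" "b \<in> gauss_ints" "c \<in> gauss_ints" "d \<in> gauss_ints"
    and xeq: "x = a * 1 + b * \<eta> + c * \<phi> + d * \<psi>" by (rule gauss_latticeE)
  obtain a\<^sub>0 a\<^sub>1 where a: "a = of_int a\<^sub>0 + \<i> * of_int a\<^sub>1" using G(1) by (rule gauss_intsE)
  obtain b\<^sub>0 b\<^sub>1 where b: "b = of_int b\<^sub>0 + \<i> * of_int b\<^sub>1" using G(2) by (rule gauss_intsE)
  obtain c\<^sub>0 c\<^sub>1 where c: "c = of_int c\<^sub>0 + \<i> * of_int c\<^sub>1" using G(3) by (rule gauss_intsE)
  obtain d\<^sub>0 d\<^sub>1 where d: "d = of_int d\<^sub>0 + \<i> * of_int d\<^sub>1" using G(4) by (rule gauss_intsE)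
  \<comment> \<open>Multiples of \<i> are rewritten by
    \<open>\<i> * \<phi> = \<phi> - \<theta>^2\<close>,
    \<open>\<i> * \<psi> = \<psi> - \<theta> ^ 3\<close> and
    \<open>\<i> * \<eta> = \<eta> + \<psi> - \<theta> - \<theta> ^ 3\<close>.\<close>
  define n where "n = (!) [a\<^sub>0, - b\<^sub>1, - c\<^sub>1, - b\<^sub>1 - d\<^sub>1, a\<^sub>1, b\<^sub>0 + b\<^sub>1, c\<^sub>0 + c\<^sub>1, b\<^sub>1 + d\<^sub>0 + d\<^sub>1]"
  have "x = (\<Sum>i<length ?bs. of_int (n i) * ?bs ! i)"
    unfolding expand xeq a b c d by (simp add: n_def gev_def defs field_simps)
  then show "\<exists>n. x = (\<Sum>i<length ?bs. of_int (n i) * ?bs ! i)" by (rule exI[of _ n])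
qed

lemma integral_basis_3_mod_4:
  assumes sf: "squarefree m" and m: "int m = 4 * k - 1"
  shows "integral_basis K [1, \<theta>, \<theta>\<^sup>2, \<theta> ^ 3, (\<i> + \<theta>\<^sup>2) / 2, (\<i> * \<theta> + \<theta> ^ 3) / 2, (1 + \<i> * \<theta>\<^sup>2) / 2, (\<theta> + \<i> * \<theta> ^ 3) / 2]"
    (is "integral_basis K ?bs")
proof (rule integral_basisI[OF K_subfield])
  define \<alpha> where "\<alpha> = (1 + \<i> * \<theta>\<^sup>2) / 2"
  note AI_simps = algebraic_int_add algebraic_int_diff algebraic_int_mult algebraic_int_power algebraic_int_theta
  have "\<alpha>\<^sup>2 = \<alpha> - of_int k" using square_3_mod_4[OF m] by (simp add: \<alpha>_def)
  then have "poly [:of_int k, - 1, 1:] \<alpha> = 0" by (simp add: power2_eq_square algebra_simps)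
  then have alpha: "algebraic_int \<alpha>"
    by (intro algebraic_int.intros[of "[:of_int k, - 1, 1:]"]) (auto simp: coeff_pCons split: nat.splits)
  have others: "(\<i> + \<theta>\<^sup>2) / 2 = \<i> * (1 - \<alpha>)" "(\<i> * \<theta> + \<theta> ^ 3) / 2 = \<theta> * (\<i> * (1 - \<alpha>))"
    "(\<theta> + \<i> * \<theta> ^ 3) / 2 = \<theta> * \<alpha>"
    by (simp_all add: \<alpha>_def field_simps power2_eq_square power3_eq_cube)
  have "\<forall>b\<in>set ?bs. b \<in> K"
    by simp
  moreover have "\<forall>b\<in>set ?bs. algebraic_int b"
    using alpha unfolding others \<alpha>_def[symmetric] by (simp add: AI_simps)
  ultimately show "b \<in> K \<and> algebraic_int b" if "b \<in> set ?bs" for b using that by blast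
  have expand: "(\<Sum>i<length ?bs. of_int (n i) * ?bs ! i) =
      gev \<theta> (of_int (n 0) + of_int (n 6) / 2 + \<i> * of_int (n 4) / 2)
        (of_int (n 1) + of_int (n 7) / 2 + \<i> * of_int (n 5) / 2)
        (of_int (n 2) + of_int (n 4) / 2 + \<i> * of_int (n 6) / 2)
        (of_int (n 3) + of_int (n 5) / 2 + \<i> * of_int (n 7) / 2)" for n
    by (subst sum_basis_8) (simp_all add: gev_def algebra_simps add_divide_distrib)
  show "n i = 0" if eq: "(\<Sum>i<length ?bs. of_int (n i) * ?bs ! i) = 0" and i: "i < length ?bs" for n i
  proof -
    have "of_int (n 0) + of_int (n 6) / 2 + \<i> * of_int (n 4) / 2 = 0 \<and>
        of_int (n 1) + of_int (n 7) / 2 + \<i> * of_int (n 5) / 2 = 0 \<and>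
        of_int (n 2) + of_int (n 4) / 2 + \<i> * of_int (n 6) / 2 = 0 \<and>
        of_int (n 3) + of_int (n 5) / 2 + \<i> * of_int (n 7) / 2 = 0"
      using eq unfolding expand by (intro gev_eq_0[OF theta]) auto
    then have "\<forall>i<8. n i = 0"
      by (auto simp: complex_eq_iff elim!: less_8_cases)
    then show ?thesis using i by simp
  qed
  fix x assume x: "x \<in> K" "algebraic_int x"
  have "x \<in> gauss_lattice 1 \<alpha> \<theta> (\<theta> * \<alpha>)"
  proof (rule integers_subset_gauss_lattice[OF sf x algebraic_int_1 alpha algebraic_int_theta
        algebraic_int_mult[OF algebraic_int_theta alpha]])
    fix a b c d :: int
    assume "a \<in> {0, 1}" "b \<in> {0, 1}" "c \<in> {0, 1}" "d \<in> {0, 1}"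
      "algebraic_int ((of_int a * 1 + of_int b * \<alpha> + of_int c * \<theta> + of_int d * (\<theta> * \<alpha>)) / (1 + \<i>))"
    then show "a = 0 \<and> b = 0 \<and> c = 0 \<and> d = 0"
      by (rule basis_saturated_3_mod_4[OF m _ _ _ _ alpha \<alpha>_def])
  next
    fix a b c d assume "a \<in> gauss_ints" "b \<in> gauss_ints" "c \<in> gauss_ints" "d \<in> gauss_ints"
    \<comment> \<open>This substitutes
      \<open>\<theta>^2 = \<i> - 2 * \<i> * \<alpha>\<close>.\<close>
    moreover have "gev \<theta> a b c d = (a + \<i> * c) * 1 + (- 2 * \<i> * c) * \<alpha> + (b + \<i> * d) * \<theta> + (- 2 * \<i> * d) * (\<theta> * \<alpha>)"
      by (simp add: gev_def \<alpha>_def field_simps power2_eq_square power3_eq_cube)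
    ultimately show "gev \<theta> a b c d \<in> gauss_lattice 1 \<alpha> \<theta> (\<theta> * \<alpha>)"
      unfolding gauss_lattice_def
      by (blast intro: gauss_ints_closed)
  qed
  then obtain a b c d where G: "a \<in> gauss_ints" "b \<in> gauss_ints" "c \<in> gauss_ints" "d \<in> gauss_ints"
    and xeq: "x = a * 1 + b * \<alpha> + c * \<theta> + d * (\<theta> * \<alpha>)" by (rule gauss_latticeE)
  obtain a\<^sub>0 a\<^sub>1 where a: "a = of_int a\<^sub>0 + \<i> * of_int a\<^sub>1" using G(1) by (rule gauss_intsE)
  obtain b\<^sub>0 b\<^sub>1 where b: "b = of_int b\<^sub>0 + \<i> * of_int b\<^sub>1" using G(2) by (rule gauss_intsE)
  obtain c\<^sub>0 c\<^sub>1 where c: "c = of_int c\<^sub>0 + \<i> * of_int c\<^sub>1" using G(3) by (rule gauss_intsE)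
  obtain d\<^sub>0 d\<^sub>1 where d: "d = of_int d\<^sub>0 + \<i> * of_int d\<^sub>1" using G(4) by (rule gauss_intsE)
  \<comment> \<open>With \<open>\<beta> = (\<i> + \<theta>^2) / 2\<close> one has
    \<open>\<i> = 2 * \<beta> - \<theta>^2\<close> and
    \<open>\<i> * \<alpha> = \<beta> - \<theta>^2\<close>; the odd positions repeat this times
    \<theta>.\<close>
  define n where "n = (!) [a\<^sub>0, c\<^sub>0, - a\<^sub>1 - b\<^sub>1, - c\<^sub>1 - d\<^sub>1, 2 * a\<^sub>1 + b\<^sub>1, 2 * c\<^sub>1 + d\<^sub>1, b\<^sub>0, d\<^sub>0]"
  have "x = gev \<theta> (a + b / 2) (c + d / 2) (\<i> * b / 2) (\<i> * d / 2)"
    unfolding xeq gev_def \<alpha>_def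
    by (simp add: algebra_simps add_divide_distrib power2_eq_square power3_eq_cube)
  also have "a + b / 2 = of_int (n 0) + of_int (n 6) / 2 + \<i> * of_int (n 4) / 2"
    by (simp add: n_def a b complex_eq_iff)
  also have "c + d / 2 = of_int (n 1) + of_int (n 7) / 2 + \<i> * of_int (n 5) / 2"
    by (simp add: n_def c d complex_eq_iff)
  also have "\<i> * b / 2 = of_int (n 2) + of_int (n 4) / 2 + \<i> * of_int (n 6) / 2"
    by (simp add: n_def b complex_eq_iff)
  also have "\<i> * d / 2 = of_int (n 3) + of_int (n 5) / 2 + \<i> * of_int (n 7) / 2"
    by (simp add: n_def d complex_eq_iff)
  also note expand[symmetric]
  finally have "x = (\<Sum>i<length ?bs. of_int (n i) * ?bs ! i)" .
  then show "\<exists>n. x = (\<Sum>i<length ?bs. of_int (n i) * ?bs ! i)" by (rule exI[of _ n])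
qed

lemma basis_discriminant_2_mod_4:
  "basis_discriminant K [1, \<theta>, \<theta>\<^sup>2, \<theta> ^ 3, \<i>, ((1 + \<i>) * \<theta> + \<theta> ^ 3) / 2, (1 + \<i>) * \<theta>\<^sup>2 / 2, (1 + \<i>) * \<theta> ^ 3 / 2] =
     2 ^ 18 * of_nat m ^ 6"
  (is "basis_discriminant K ?bs = _")
proof -
  define P :: "nat \<Rightarrow> nat \<Rightarrow> rat" where "P i j = [[1, 0, 0, 0, 0, 0, 0, 0], [0, 1, 0, 0, 0, 0, 0, 0],
    [0, 0, 1, 0, 0, 0, 0, 0], [0, 0, 0, 1, 0, 0, 0, 0], [0, 0, 0, 0, 1, 0, 0, 0],
    [0, 1/2, 0, 1/2, 0, 1/2, 0, 0], [0, 0, 1/2, 0, 0, 0, 1/2, 0], [0, 0, 0, 1/2, 0, 0, 0, 1/2]] ! i ! j" for i j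
  have "basis_discriminant K ?bs = (of_rat (\<Prod>i<8. P i i))\<^sup>2 * (2 ^ 24 * of_nat m ^ 6)"
  proof (rule basis_discriminant_triangular[where P = P])
    show "?bs ! i = (\<Sum>j<8. of_rat (P i j) * monomials ! j)" if "i < 8" for i
      using that by (rule less_8_cases)
        (simp_all add: sum_lessThan_8 P_def monomials_def of_rat_divide field_simps)
    show "P i j = 0" if "i < j" "j < 8" for i j
      using that(2) by (rule less_8_cases; use that(1) in \<open>auto simp: P_def less_Suc_eq numeral_eq_Suc\<close>)
  qed simp
  \<comment> \<open>Three diagonal entries are 1/2, which lowers the exponent 24 by 6.\<close>
  also have "(\<Prod>i<8. P i i) = 1 / 8"
    by (simp add: P_def prod_lessThan_8)
  finally show ?thesis by (simp add: of_rat_divide power_divide)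
qed

lemma basis_discriminant_3_mod_4:
  "basis_discriminant K [1, \<theta>, \<theta>\<^sup>2, \<theta> ^ 3, (\<i> + \<theta>\<^sup>2) / 2, (\<i> * \<theta> + \<theta> ^ 3) / 2, (1 + \<i> * \<theta>\<^sup>2) / 2, (\<theta> + \<i> * \<theta> ^ 3) / 2] =
     2 ^ 16 * of_nat m ^ 6"
  (is "basis_discriminant K ?bs = _")
proof -
  define P :: "nat \<Rightarrow> nat \<Rightarrow> rat" where "P i j = [[1, 0, 0, 0, 0, 0, 0, 0], [0, 1, 0, 0, 0, 0, 0, 0],
    [0, 0, 1, 0, 0, 0, 0, 0], [0, 0, 0, 1, 0, 0, 0, 0], [0, 0, 1/2, 0, 1/2, 0, 0, 0],
    [0, 0, 0, 1/2, 0, 1/2, 0, 0], [1/2, 0, 0, 0, 0, 0, 1/2, 0], [0, 1/2, 0, 0, 0, 0, 0, 1/2]] ! i ! j" for i j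
  have "basis_discriminant K ?bs = (of_rat (\<Prod>i<8. P i i))\<^sup>2 * (2 ^ 24 * of_nat m ^ 6)"
  proof (rule basis_discriminant_triangular[where P = P])
    show "?bs ! i = (\<Sum>j<8. of_rat (P i j) * monomials ! j)" if "i < 8" for i
      using that by (rule less_8_cases)
        (simp_all add: sum_lessThan_8 P_def monomials_def of_rat_divide field_simps)
    show "P i j = 0" if "i < j" "j < 8" for i j
      using that(2) by (rule less_8_cases; use that(1) in \<open>auto simp: P_def less_Suc_eq numeral_eq_Suc\<close>)
  qed simp
  \<comment> \<open>Four diagonal entries are 1/2, which lowers the exponent 24 by 8.\<close>
  also have "(\<Prod>i<8. P i i) = 1 / 16"
    by (simp add: P_def prod_lessThan_8)
  finally show ?thesis by (simp add: of_rat_divide power_divide)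
qed

end

theorem theorem2:
  fixes m :: nat and \<theta> :: complex and K :: "complex set"
  assumes "m > 0" and "squarefree m"
  defines "\<theta> \<equiv> complex_of_real (root 4 (real m))"
  defines "K \<equiv> rat_adjoin {\<i>, \<theta>}"
  shows "([m = 2] (mod 4) \<longrightarrow>
           integral_basis K
             [1, \<theta>, \<theta>^2, \<theta>^3,
              \<i>, ((1 + \<i>) * \<theta> + \<theta>^3) / 2, (1 + \<i>) * \<theta>^2 / 2, (1 + \<i>) * \<theta>^3 / 2] \<and>
           field_discriminant K = 2^18 * int m^6) \<and>
         ([m = 3] (mod 4) \<longrightarrow>
           integral_basis K
             [1, \<theta>, \<theta>^2, \<theta>^3,
              (\<i> + \<theta>^2) / 2, (\<i> * \<theta> + \<theta>^3) / 2, (1 + \<i> * \<theta>^2) / 2, (\<theta> + \<i> * \<theta>^3) / 2] \<and>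
           field_discriminant K = 2^16 * int m^6)"
proof -
  have theta: "\<theta> ^ 4 = of_nat m"
  proof -
    have "root 4 (real m) ^ 4 = real m" by simp
    then have "complex_of_real (root 4 (real m) ^ 4) = of_nat m" by simp
    then show ?thesis by (simp only: \<theta>_def of_real_power)
  qed
  \<comment> \<open>Squares are 0 or 1 modulo 4, so both residue classes of the theorem satisfy
    \<open>nonsquare\<close>.\<close>
  have square_mod: "k\<^sup>2 mod 4 \<in> {0, 1}" for k :: nat
  proof (cases "even k")
    case True
    then show ?thesis by (auto elim!: evenE simp: power_mult_distrib)
  next
    case False
    then obtain l where "k = 2 * l + 1" by (elim oddE)
    then have "k\<^sup>2 = 4 * (l\<^sup>2 + l) + 1" by (simp add: power2_eq_square algebra_simps)
    then show ?thesis by simp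
  qed
  have quartic: "quartic_field m \<theta>" if "m mod 4 \<notin> {0, 1}"
  proof
    show "k\<^sup>2 \<noteq> m" for k using that square_mod[of k] by auto
  qed (rule theta)
  have K_eq: "K = quartic_field.K \<theta>" if "m mod 4 \<notin> {0, 1}"
    unfolding K_def by (rule quartic_field.rat_adjoin_eq[OF quartic[OF that]])
  show ?thesis
  proof (intro conjI[of "_ \<longrightarrow> _"] impI)
    assume "[m = 2] (mod 4)"
    then have mod: "m mod 4 = 2" by (simp add: Cong.cong_def)
    then interpret quartic_field m \<theta> by (intro quartic) simp
    have K: "K = quartic_field.K \<theta>" using mod by (intro K_eq) simp
    obtain j where "int m = 4 * j + 2"
      using mod by (metis add.commute div_mult_mod_eq mult.commute of_nat_add of_nat_mult of_nat_numeral)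
    from integral_basis_2_mod_4[OF assms(2) this]
    show "integral_basis K [1, \<theta>, \<theta>^2, \<theta>^3,
        \<i>, ((1 + \<i>) * \<theta> + \<theta>^3) / 2, (1 + \<i>) * \<theta>^2 / 2, (1 + \<i>) * \<theta>^3 / 2] \<and>
      field_discriminant K = 2^18 * int m^6"
      using field_discriminant_eqI[OF K_subfield] basis_discriminant_2_mod_4 unfolding K by simp
  next
    assume "[m = 3] (mod 4)"
    then have mod: "m mod 4 = 3" by (simp add: Cong.cong_def)
    then interpret quartic_field m \<theta> by (intro quartic) simp
    have K: "K = quartic_field.K \<theta>" using mod by (intro K_eq) simp
    obtain q where "m = 4 * q + 3"
      using mod by (metis add.commute div_mult_mod_eq mult.commute)
    then have "int m = 4 * (int q + 1) - 1" by simp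
    from integral_basis_3_mod_4[OF assms(2) this]
    show "integral_basis K [1, \<theta>, \<theta>^2, \<theta>^3,
        (\<i> + \<theta>^2) / 2, (\<i> * \<theta> + \<theta>^3) / 2, (1 + \<i> * \<theta>^2) / 2, (\<theta> + \<i> * \<theta>^3) / 2] \<and>
      field_discriminant K = 2^16 * int m^6"
      using field_discriminant_eqI[OF K_subfield] basis_discriminant_3_mod_4 unfolding K by simp
  qed
qed

end
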